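(* Let $G$ be a totally bounded abelian topological group such that its dual group $\widehat{G}_p$, equipped with the finite-open topology, is a Baire group (i.e. a Baire space). Then every compact subset of $G$ is finite.
   Context: $\mathbb{T}$ is the circle group $\mathbb{R}/\mathbb{Z}$. A topological group $G$ (written additively) is precompact if for every nonempty open $U\subseteq G$ there is a finite $F\subseteq G$ with $G=F+U$; it is totally bounded if it is precompact and Hausdorff. For an abelian topological group $G$, $\widehat{G}$ is the group (under pointwise operations) of all continuous homomorphisms $G\to\mathbb{T}$, and $\widehat{G}_p$ is $\widehat{G}$ with the finite-open topology $\sigma(\widehat{G},G)$, i.e. the topology of pointwise convergence on the elements of $G$. A space is Baire if every countable intersection of dense open subsets is dense. *)

theory Defs
  imports "HOL-Analysis.Analysis"
begin

section \<open>The circle group \<open>\<real>/\<int>\<close>\<close>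

quotient_type circle = real / "\<lambda>x y. x - y \<in> \<int>"
  morphisms rep_circle to_circle
proof (rule equivpI)
  show "reflp (\<lambda>x y::real. x - y \<in> \<int>)"
    by (simp add: reflp_def)
  show "symp (\<lambda>x y::real. x - y \<in> \<int>)"
  proof (rule sympI)
    fix x y :: real
    assume "x - y \<in> \<int>"
    then have "- (x - y) \<in> \<int>" by (rule Ints_minus)
    then show "y - x \<in> \<int>" by simp
  qed
  show "transp (\<lambda>x y::real. x - y \<in> \<int>)"
  proof (rule transpI)
    fix x y z :: real
    assume "x - y \<in> \<int>" "y - z \<in> \<int>"
    then have "(x - y) + (y - z) \<in> \<int>" by (rule Ints_add)
    then show "x - z \<in> \<int>" by simp
  qed
qed

instantiation circle :: ab_group_add
begin

lift_definition zero_circle :: circle is 0 .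

lift_definition plus_circle :: "circle \<Rightarrow> circle \<Rightarrow> circle" is "(+)"
proof -
  fix a b c d :: real
  assume "a - b \<in> \<int>" "c - d \<in> \<int>"
  then have "(a - b) + (c - d) \<in> \<int>" by (rule Ints_add)
  then show "(a + c) - (b + d) \<in> \<int>" by (simp add: algebra_simps)
qed

lift_definition uminus_circle :: "circle \<Rightarrow> circle" is uminus
proof -
  fix a b :: real
  assume "a - b \<in> \<int>"
  then have "- (a - b) \<in> \<int>" by (rule Ints_minus)
  then show "- a - - b \<in> \<int>" by simp
qed

lift_definition minus_circle :: "circle \<Rightarrow> circle \<Rightarrow> circle" is "(-)"
proof -
  fix a b c d :: real
  assume "a - b \<in> \<int>" "c - d \<in> \<int>"
  then have "(a - b) - (c - d) \<in> \<int>" by (rule Ints_diff)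
  then show "(a - c) - (b - d) \<in> \<int>" by (simp add: algebra_simps)
qed

instance
  by standard (transfer, simp)+

end

instantiation circle :: topological_space
begin

definition open_circle :: "circle set \<Rightarrow> bool"
  where "open_circle U \<longleftrightarrow> open (to_circle -` U)"

instance
  by standard (auto simp: open_circle_def vimage_Union intro: open_Int)

end

lemma quotient_map_to_circle: "quotient_map euclidean euclidean to_circle"
proof -
  have "surj to_circle"
    by (metis Quotient3_abs_rep Quotient3_circle surjI)
  then show ?thesis
    by (simp add: quotient_map_def open_circle_def vimage_def)
qed

lemma to_circle_add: "to_circle (x + y) = to_circle x + to_circle y"
  by (simp add: plus_circle.abs_eq)

lemma to_circle_eq_iff: "to_circle x = to_circle y \<longleftrightarrow> x - y \<in> \<int>"
  by (rule circle.abs_eq_iff)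

lemma isCont_to_circle: "isCont to_circle x"
proof -
  have "continuous_on UNIV to_circle"
    by (simp add: continuous_on_open_vimage open_circle_def)
  then show ?thesis
    by (simp add: continuous_on_eq_continuous_at)
qed

lemma open_image_to_circle:
  assumes "open S"
  shows "open (to_circle ` S)"
proof -
  have "to_circle -` to_circle ` S = (\<Union>n::int. (+) (of_int n) ` S)"
  proof (intro set_eqI iffI)
    fix x
    assume "x \<in> to_circle -` to_circle ` S"
    then obtain s where s: "s \<in> S" "x - s \<in> \<int>"
      by (auto simp: to_circle_eq_iff)
    then obtain n where "x - s = of_int n" by (auto elim: Ints_cases)
    then have "x = of_int n + s" by simp
    with s show "x \<in> (\<Union>n::int. (+) (of_int n) ` S)" by blast
  next
    fix x
    assume "x \<in> (\<Union>n::int. (+) (of_int n) ` S)"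
    then obtain n :: int and s where "s \<in> S" "x = of_int n + s" by blast
    then have "to_circle x = to_circle s" by (simp add: to_circle_eq_iff)
    with \<open>s \<in> S\<close> show "x \<in> to_circle -` to_circle ` S" by auto
  qed
  then show ?thesis
    using assms by (auto simp: open_circle_def intro: open_translation)
qed

lemma nhds_to_circle: "nhds (to_circle x) = filtermap to_circle (nhds x)"
proof (rule antisym)
  show "filtermap to_circle (nhds x) \<le> nhds (to_circle x)"
    using isCont_to_circle[of x]
    by (simp only: isCont_def tendsto_at_iff_tendsto_nhds) (simp only: filterlim_def)
  show "nhds (to_circle x) \<le> filtermap to_circle (nhds x)"
  proof (rule filter_leI)
    fix P
    assume "eventually P (filtermap to_circle (nhds x))"
    then obtain S where "open S" "x \<in> S" "\<forall>y\<in>S. P (to_circle y)"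
      by (auto simp: eventually_filtermap eventually_nhds)
    then show "eventually P (nhds (to_circle x))"
      unfolding eventually_nhds
      by (intro exI[of _ "to_circle ` S"]) (auto intro: open_image_to_circle)
  qed
qed

instance circle :: topological_ab_group_add
proof
  fix a b :: circle
  obtain x y where xy: "a = to_circle x" "b = to_circle y"
    by (metis Quotient3_abs_rep Quotient3_circle)
  have "((\<lambda>p. fst p + snd p) \<longlongrightarrow> x + y) (nhds x \<times>\<^sub>F nhds y)"
    by (rule tendsto_add_Pair)
  then have "((\<lambda>p. to_circle (fst p + snd p)) \<longlongrightarrow> to_circle (x + y)) (nhds x \<times>\<^sub>F nhds y)"
    by (rule isCont_tendsto_compose[OF isCont_to_circle])
  then show "((\<lambda>p. fst p + snd p) \<longlongrightarrow> a + b) (nhds a \<times>\<^sub>F nhds b)"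
    by (simp add: xy nhds_to_circle filterlim_filtermap to_circle_add
        prod_filtermap1 prod_filtermap2 apfst_def apsnd_def map_prod_def case_prod_unfold)
next
  fix a :: circle
  obtain x where x: "a = to_circle x"
    by (metis Quotient3_abs_rep Quotient3_circle)
  have "(uminus \<longlongrightarrow> - x) (nhds x)"
    by (rule tendsto_uminus_nhds)
  then have "((\<lambda>y. to_circle (- y)) \<longlongrightarrow> to_circle (- x)) (nhds x)"
    by (rule isCont_tendsto_compose[OF isCont_to_circle])
  then show "(uminus \<longlongrightarrow> - a) (nhds a)"
    by (simp add: x nhds_to_circle filterlim_filtermap uminus_circle.abs_eq)
qed

section \<open>Precompact and totally bounded groups\<close>

text \<open>\<open>F + U\<close> is the elementwise sum of \<^theory>\<open>HOL-Library.Set_Algebras\<close>.\<close>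

definition precompact_group :: "'a::topological_group_add itself \<Rightarrow> bool"
  where "precompact_group _ \<longleftrightarrow>
    (\<forall>U :: 'a set. open U \<and> U \<noteq> {} \<longrightarrow> (\<exists>F. finite F \<and> F + U = UNIV))"

definition totally_bounded_group :: "'a::topological_group_add itself \<Rightarrow> bool"
  where "totally_bounded_group G \<longleftrightarrow>
    precompact_group G \<and> Hausdorff_space (euclidean :: 'a topology)"

section \<open>The dual group with the finite-open topology\<close>

definition dual_group :: "('a::topological_ab_group_add \<Rightarrow> circle) set"
  where "dual_group = {h. Modules.additive h \<and> continuous_on UNIV h}"

text \<open>
  The trace on \<open>dual_group\<close> of the product topology on all functions, i.e. of the topology
  of pointwise convergence.
\<close>

definition dual_group_p :: "('a::topological_ab_group_add \<Rightarrow> circle) topology"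
  where "dual_group_p = subtopology (product_topology (\<lambda>_. euclidean) UNIV) dual_group"

section \<open>Baire spaces\<close>

definition Baire_space :: "'a topology \<Rightarrow> bool"
  where "Baire_space X \<longleftrightarrow>
    (\<forall>\<U>. countable \<U> \<and> (\<forall>U\<in>\<U>. openin X U \<and> X closure_of U = topspace X)
      \<longrightarrow> X closure_of (topspace X \<inter> \<Inter>\<U>) = topspace X)"

end

theory Submission
  imports Defs
begin

text \<open>
  Suppose \<open>K\<close> is compact and infinite. Then \<open>K\<close> contains a point \<open>a\<close> and countably many infinite
  sets \<open>E\<^sub>k\<close> such that every neighbourhood of \<open>a\<close> contains some \<open>E\<^sub>k\<close>. By continuity, the closed sets
  of characters \<open>\<gamma>\<close> that stay within \<open>1/8\<close> of \<open>\<gamma> a\<close> on \<open>E\<^sub>k\<close> cover the dual group, so the Baire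
  property gives one of them nonempty interior. The dual group is precompact under pointwise
  convergence, hence finitely many translates of this interior cover it, and by pigeonhole two
  distinct points of \<open>E\<^sub>k\<close> are uniformly close under all characters. Since the values of the
  characters at a point form a subgroup of the circle, all characters agree at these two points.

  This contradicts the fact that the characters of a totally bounded group separate points. The
  fact is proved without Haar measure: for finitely many elements an approximate character is found
  as a large Fourier coefficient on a finite group \<open>(\<int>/R)\<^sup>E\<close>, in the style of Bogolyubov and Folner,
  and a compactness argument turns the approximate characters into a character.
\<close>

section \<open>A countable network at a point of an infinite compact space\<close>

text \<open>Take an open set \<open>M\<close> maximal among those containing no \<open>D s\<close>.
  An open \<open>U\<close> around a point outside \<open>M\<close> enlarges it, so
  \<open>M \<union> U\<close> contains some \<open>D s\<close>, and what \<open>M\<close> leaves of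
  that \<open>D s\<close> lies in \<open>U\<close>. The nodes \<open>s\<close> are countable in
  number.\<close>

lemma Zorn_tree_network:
  fixes D :: "bool list \<Rightarrow> 'a set"
  assumes cpt: "compact_space X"
    and cl: "\<And>s. closedin X (D s)"
    and ne: "\<And>s. D s \<noteq> {}"
    and sub: "\<And>b s. D (b # s) \<subseteq> D s"
    and disj: "\<And>s. D (True # s) \<inter> D (False # s) = {}"
  shows "\<exists>a\<in>topspace X. \<exists>E :: nat \<Rightarrow> 'a set. (\<forall>k. infinite (E k)) \<and>
    (\<forall>U. openin X U \<and> a \<in> U \<longrightarrow> (\<exists>k. E k \<subseteq> U))"
proof -
  define \<A> where "\<A> = {V. openin X V \<and> (\<forall>s. \<not> D s \<subseteq> V)}"
  have "{} \<in> \<A>" using ne by (simp add: \<A>_def)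
  moreover have "\<Union>\<C> \<in> \<A>" if "\<C> \<noteq> {}" and ch: "subset.chain \<A> \<C>" for \<C>
  proof -
    have sub\<C>: "\<C> \<subseteq> \<A>" using ch by (simp add: subset.chain_def)
    then have op: "openin X V" if "V \<in> \<C>" for V using that by (auto simp: \<A>_def)
    \<comment> \<open>A compact \<open>D s\<close> covered by a chain of open sets is covered by
      finitely many of them, hence by the largest of these.\<close>
    have "\<not> D s \<subseteq> \<Union>\<C>" for s
    proof
      assume "D s \<subseteq> \<Union>\<C>"
      moreover have "compactin X (D s)" using cpt cl by (rule closedin_compact_space)
      ultimately obtain \<F> where \<F>: "finite \<F>" "\<F> \<subseteq> \<C>" "D s \<subseteq> \<Union>\<F>"
        unfolding compactin_def using op by meson
      have "\<F> \<noteq> {}" using \<F> ne[of s] by auto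
      have "subset.chain \<A> \<F>" using ch \<F>(2) unfolding subset_chain_def by (meson subsetD subset_trans)
      then have "\<Union>\<F> \<in> \<F>"
        by (rule Union_in_chain[OF \<F>(1) \<open>\<F> \<noteq> {}\<close>])
      then show False using \<F> sub\<C> by (auto simp: \<A>_def)
    qed
    then show ?thesis using op by (auto simp: \<A>_def)
  qed
  ultimately obtain M where M: "M \<in> \<A>" and max: "\<And>V. V \<in> \<A> \<Longrightarrow> M \<subseteq> V \<Longrightarrow> V = M"
    using subset_Zorn_nonempty[of \<A>] by blast
  define E where "E s = D s - M" for s
  have Ene: "E s \<noteq> {}" for s using M by (auto simp: E_def \<A>_def)
  \<comment> \<open>The two children are disjoint and nonempty, hence proper subsets of the parent,
    so a finite \<open>E s\<close> would start an infinite descent of cardinalities.\<close>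
  have inf: "infinite (E s)" for s
  proof
    assume "finite (E s)"
    then show False
    proof (induction "card (E s)" arbitrary: s rule: less_induct)
      case less
      have "E (True # s) \<union> E (False # s) \<subseteq> E s" and dj: "E (True # s) \<inter> E (False # s) = {}"
        using sub disj by (fastforce simp: E_def)+
      then have "E (True # s) \<subset> E s" using Ene[of "False # s"] by blast
      then show False
        using less by (meson finite_subset psubset_card_mono psubset_imp_subset)
    qed
  qed
  obtain a where a: "a \<in> E []" using Ene by blast
  have "\<exists>s. E s \<subseteq> U" if "openin X U" "a \<in> U" for U
  proof -
    have "M \<union> U \<noteq> M" using a that by (auto simp: E_def)
    then have "M \<union> U \<notin> \<A>" using max by blast
    then show ?thesis using M that by (auto simp: \<A>_def E_def)
  qed
  moreover have "a \<in> topspace X" using a cl[of "[]"] closedin_subset by (fastforce simp: E_def)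
  ultimately show ?thesis
    using inf by (intro bexI[of _ a] exI[of _ "\<lambda>k. E (from_nat k)"] conjI allI impI) (simp_all, metis from_nat_to_nat)
qed

text \<open>
  If an accumulation point is isolated among the accumulation points, a sequence converges to it.
  Otherwise the accumulation points carry a Cantor scheme of closed sets.
\<close>

lemma infinite_compact_countable_network_at_point:
  assumes cpt: "compact_space X" and haus: "Hausdorff_space X" and inf: "infinite (topspace X)"
  shows "\<exists>a\<in>topspace X. \<exists>E :: nat \<Rightarrow> 'a set. (\<forall>k. infinite (E k)) \<and>
    (\<forall>U. openin X U \<and> a \<in> U \<longrightarrow> (\<exists>k. E k \<subseteq> U))"
proof -
  \<comment> \<open>\<open>P\<close> consists of the points all of whose open neighbourhoods are
    infinite; \<open>W\<close> is its complement.\<close>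
  define W where "W = \<Union>{V. openin X V \<and> finite V}"
  define P where "P = topspace X - W"
  have nb: "\<exists>V C. openin X V \<and> closedin X C \<and> x \<in> V \<and> V \<subseteq> C \<and> C \<subseteq> U"
    if "openin X U" "x \<in> U" for U x
    using compact_Hausdorff_imp_regular_space[OF cpt haus] that
    by (metis neighbourhood_base_of neighbourhood_base_of_closedin)
  have fin: "finite C" if "closedin X C" "C \<inter> P = {}" for C
  proof -
    have "compactin X C" using cpt that(1) by (rule closedin_compact_space)
    moreover have "C \<subseteq> W" using closedin_subset[OF that(1)] that(2) by (auto simp: P_def)
    then have "C \<subseteq> \<Union>{V. openin X V \<and> finite V}" by (simp only: W_def)
    ultimately obtain \<F> where \<F>: "finite \<F>" "\<F> \<subseteq> {V. openin X V \<and> finite V}" "C \<subseteq> \<Union>\<F>"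
      unfolding compactin_def by (metis (no_types, lifting) mem_Collect_eq)
    then have "finite (\<Union>\<F>)" by blast
    then show ?thesis using \<F>(3) by (rule rev_finite_subset)
  qed
  have accum: "infinite V" if "openin X V" "V \<inter> P \<noteq> {}" for V
    using that by (auto simp: P_def W_def)
  have Pne: "P \<noteq> {}" using fin[of "topspace X"] inf by auto
  show ?thesis
  proof (cases "\<exists>a V. openin X V \<and> V \<inter> P = {a}")
    case True
    then obtain a V where V: "openin X V" "V \<inter> P = {a}" by blast
    then obtain V' C where C: "openin X V'" "closedin X C" "a \<in> V'" "V' \<subseteq> C" "C \<subseteq> V"
      using nb[of V a] by blast
    have "infinite V'" using accum[of V'] C V by blast
    then have "infinite C" using C finite_subset by blast
    \<comment> \<open>Any injective sequence in \<open>C\<close> converges to \<open>a\<close>: what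
      remains of \<open>C\<close> outside an open neighbourhood of \<open>a\<close> is closed and
      misses \<open>P\<close>, hence is finite.\<close>
    then obtain e :: "nat \<Rightarrow> 'a" where e: "inj e" "range e \<subseteq> C"
      using infinite_countable_subset by blast
    have "\<exists>k. e ` {k..} \<subseteq> U" if U: "openin X U" "a \<in> U" for U
    proof -
      have "finite (C - U)"
        by (rule fin) (use C V U in \<open>auto intro: closedin_diff\<close>)
      then have "finite (e -` (C - U))" using e by (simp add: finite_vimageI)
      then obtain k where k: "\<forall>i\<in>e -` (C - U). i < k" using finite_nat_set_iff_bounded by blast
      have "e i \<in> U" if "k \<le> i" for i
        using that e(2) k by (meson DiffI leD rangeI subsetD vimageI2)
      then have "e ` {k..} \<subseteq> U" by blast
      then show ?thesis ..
    qed
    moreover have "infinite (e ` {k..})" for k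
      using e by (metis finite_imageD inj_on_subset infinite_Ici subset_UNIV)
    moreover have "a \<in> topspace X" using V by (auto simp: P_def)
    ultimately show ?thesis
      by (intro bexI[of _ a] exI[of _ "\<lambda>k. e ` {k..}"] conjI allI impI) simp_all
  next
    case False
    \<comment> \<open>The members of the Cantor scheme contain an open set that meets
      \<open>P\<close>. Such an open set meets \<open>P\<close> in at least two points, as no single
      point of \<open>P\<close> can be cut out; separating the two gives disjoint good
      subsets.\<close>
    define good where
      "good D \<longleftrightarrow> closedin X D \<and> (\<exists>V. openin X V \<and> V \<subseteq> D \<and> V \<inter> P \<noteq> {})" for D
    have split: "\<exists>C D'. good C \<and> good D' \<and> C \<subseteq> D \<and> D' \<subseteq> D \<and> C \<inter> D' = {}" if D: "good D" for D
    proof -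
      obtain V where V: "openin X V" "V \<subseteq> D" "V \<inter> P \<noteq> {}" using D by (auto simp: good_def)
      then obtain p where p: "p \<in> V" "p \<in> P" by blast
      moreover have "V \<inter> P \<noteq> {p}" using False V by blast
      ultimately obtain q where q: "q \<in> V" "q \<in> P" "q \<noteq> p" by blast
      have "openin X (V - {q})"
        using V haus q by (meson closedin_Hausdorff_sing_eq openin_diff openin_subset subsetD)
      then obtain A C where A: "openin X A" "closedin X C" "p \<in> A" "A \<subseteq> C" "C \<subseteq> V - {q}"
        using nb[of "V - {q}" p] p q by blast
      then have "openin X (V - C)" using V by blast
      then obtain A' C' where A': "openin X A'" "closedin X C'" "q \<in> A'" "A' \<subseteq> C'" "C' \<subseteq> V - C"
        using nb[of "V - C" q] q A by blast
      have "A \<inter> P \<noteq> {}" "A' \<inter> P \<noteq> {}" using A(3) p(2) A'(3) q(2) by blast+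
      then have "good C" "good C'" unfolding good_def using A(1,2,4) A'(1,2,4) by blast+
      moreover have "C \<subseteq> D" "C' \<subseteq> D" "C \<inter> C' = {}" using A(5) A'(5) V(2) by auto
      ultimately show ?thesis by metis
    qed
    obtain f g where fg: "\<And>D. good D \<Longrightarrow>
        good (f D) \<and> good (g D) \<and> f D \<subseteq> D \<and> g D \<subseteq> D \<and> f D \<inter> g D = {}"
      using split by metis
    \<comment> \<open>The head of the list is the latest choice, as \<open>Zorn_tree_network\<close>
      requires.\<close>
    define D where "D s = foldr (\<lambda>b C. if b then f C else g C) s (topspace X)" for s
    have "topspace X \<inter> P \<noteq> {}" using Pne by (auto simp: P_def)
    then have "good (topspace X)" unfolding good_def by blast
    then have good: "good (D s)" for s
      by (induction s) (auto simp: D_def fg)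
    show ?thesis
    proof (rule Zorn_tree_network[OF cpt, of D])
      show "closedin X (D s)" "D s \<noteq> {}" for s
        using good[of s] by (auto simp: good_def)
      show "D (b # s) \<subseteq> D s" "D (True # s) \<inter> D (False # s) = {}" for b s
        using fg[OF good[of s]] by (auto simp: D_def)
    qed
  qed
qed

section \<open>Fourier coefficients of subsets of \<open>(\<int>/R)\<^sup>I\<close>\<close>

lemma cis_2pi_eq_1_iff: "cis (2 * pi * x) = 1 \<longleftrightarrow> x \<in> \<int>"
proof
  assume "cis (2 * pi * x) = 1"
  then have "cos (2 * pi * x) = 1" by (simp add: complex_eq_iff)
  then obtain n :: int where "2 * pi * x = n * 2 * pi" by (auto simp: cos_one_2pi_int)
  then have "x = of_int n" by simp
  then show "x \<in> \<int>" by simp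
next
  assume "x \<in> \<int>"
  then show "cis (2 * pi * x) = 1" by (simp add: cis_multiple_2pi)
qed

lemma cis_sum: "finite I \<Longrightarrow> cis (\<Sum>i\<in>I. f i) = (\<Prod>i\<in>I. cis (f i))"
  by (induction I rule: finite_induct) (simp_all flip: cis_mult)

definition phase :: "'i set \<Rightarrow> ('i \<Rightarrow> real) \<Rightarrow> ('i \<Rightarrow> int) \<Rightarrow> complex"
  where "phase I t n = cis (2 * pi * (\<Sum>i\<in>I. t i * of_int (n i)))"

lemma norm_phase [simp]: "norm (phase I t n) = 1"
  by (simp add: phase_def)

lemma phase_add: "phase I t (\<lambda>i. m i + n i) = phase I t m * phase I t n"
  by (simp add: phase_def cis_mult ring_distribs sum.distrib)

lemma phase_uminus: "phase I t (\<lambda>i. - n i) = cnj (phase I t n)"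
  by (simp add: phase_def cis_cnj sum_negf)

lemma phase_diff: "phase I t (\<lambda>i. m i - n i) = phase I t m * cnj (phase I t n)"
  using phase_add[of I t m "\<lambda>i. - n i"] by (simp add: phase_uminus)

text \<open>Representatives of \<open>(\<int>/R)\<^sup>I\<close>, extensional so that finite
  \<open>I\<close> gives a finite set. The same set also indexes the characters, through the
  frequencies \<open>\<theta> i / R\<close>.\<close>

definition residue_box :: "'i set \<Rightarrow> int \<Rightarrow> ('i \<Rightarrow> int) set"
  where "residue_box I R = PiE I (\<lambda>_. {0..<R})"

definition box_mod :: "'i set \<Rightarrow> int \<Rightarrow> ('i \<Rightarrow> int) \<Rightarrow> 'i \<Rightarrow> int"
  where "box_mod I R n = (\<lambda>i\<in>I. n i mod R)"

lemma finite_residue_box [simp]: "finite I \<Longrightarrow> finite (residue_box I R)"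
  by (simp add: residue_box_def finite_PiE)

lemma box_mod_in_residue_box: "R > 0 \<Longrightarrow> box_mod I R n \<in> residue_box I R"
  by (auto simp: residue_box_def box_mod_def)

lemma box_cong_imp_eq:
  assumes "m \<in> residue_box I R" "n \<in> residue_box I R" "\<And>i. i \<in> I \<Longrightarrow> R dvd m i - n i"
  shows "m = n"
proof (rule PiE_ext[OF assms(1,2)[unfolded residue_box_def]])
  fix i assume i: "i \<in> I"
  then have "m i mod R = n i mod R" using assms(3) by (simp add: mod_eq_dvd_iff)
  then show "m i = n i" using assms(1,2) i by (force simp: residue_box_def)
qed

lemma inj_on_box_mod_add: "inj_on (\<lambda>n. box_mod I R (\<lambda>i. n i + b i)) (residue_box I R)"
proof (rule inj_onI)
  fix m n assume mn: "m \<in> residue_box I R" "n \<in> residue_box I R"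
    and eq: "box_mod I R (\<lambda>i. m i + b i) = box_mod I R (\<lambda>i. n i + b i)"
  show "m = n"
  proof (rule box_cong_imp_eq[OF mn])
    fix i assume "i \<in> I"
    then have "(m i + b i) mod R = (n i + b i) mod R"
      using fun_cong[OF eq, of i] by (simp add: box_mod_def)
    then show "R dvd m i - n i" by (simp add: mod_eq_dvd_iff)
  qed
qed

text \<open>Orthogonality on a cyclic group: a geometric sum over the powers of an
  \<open>R\<close>-th root of unity.\<close>

lemma sum_cis_residues:
  fixes n R :: int
  assumes "R > 0"
  shows "(\<Sum>j\<in>{0..<R}. cis (2 * pi * (of_int j / of_int R * of_int n))) =
    (if R dvd n then of_int R else 0)"
proof -
  define z where "z = cis (2 * pi * (of_int n / of_int R))"
  have "(\<Sum>j\<in>{0..<R}. cis (2 * pi * (of_int j / of_int R * of_int n))) = (\<Sum>j<nat R. z ^ j)"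
  proof (rule sum.reindex_cong)
    show "inj_on int {..<nat R}" by simp
    show "{0..<R} = int ` {..<nat R}"
      using assms by (auto simp: image_iff intro!: bexI[of _ "nat _"])
    show "cis (2 * pi * (of_int (int j) / of_int R * of_int n)) = z ^ j" for j
      by (simp add: z_def Complex.DeMoivre algebra_simps)
  qed
  also have "\<dots> = (if R dvd n then of_int R else 0)"
  proof (cases "R dvd n")
    case True
    then obtain m where "n = R * m" ..
    then have "z = 1" using assms by (simp add: z_def cis_2pi_eq_1_iff)
    then show ?thesis using True assms by simp
  next
    case False
    have "z \<noteq> 1"
    proof
      assume "z = 1"
      then obtain m :: int where "of_int n / of_int R = (of_int m :: real)"
        unfolding z_def cis_2pi_eq_1_iff by (auto elim: Ints_cases)
      then have "(of_int n :: real) = of_int (m * R)" using assms by (simp add: field_simps)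
      then have "n = m * R" by (simp only: of_int_eq_iff)
      then show False using False by simp
    qed
    moreover have "z ^ nat R = 1"
    proof -
      have "z ^ nat R = cis (2 * pi * of_int n)"
        using assms by (simp add: z_def Complex.DeMoivre)
      then show ?thesis by (simp add: cis_2pi_eq_1_iff)
    qed
    ultimately show ?thesis using False by (simp add: geometric_sum)
  qed
  finally show ?thesis .
qed

lemma sum_phase_residue_box:
  assumes "finite I" "R > 0"
  shows "(\<Sum>\<theta>\<in>residue_box I R. phase I (\<lambda>i. of_int (\<theta> i) / of_int R) n) =
    (if \<forall>i\<in>I. R dvd n i then of_nat (card (residue_box I R)) else 0)"
proof -
  have "(\<Sum>\<theta>\<in>residue_box I R. phase I (\<lambda>i. of_int (\<theta> i) / of_int R) n) =
      (\<Sum>\<theta>\<in>residue_box I R. \<Prod>i\<in>I. cis (2 * pi * (of_int (\<theta> i) / of_int R * of_int (n i))))"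
    using assms by (simp add: phase_def sum_distrib_left cis_sum)
  also have "\<dots> = (\<Prod>i\<in>I. \<Sum>j\<in>{0..<R}. cis (2 * pi * (of_int j / of_int R * of_int (n i))))"
    unfolding residue_box_def using assms by (subst prod_sum_PiE) auto
  also have "\<dots> = (\<Prod>i\<in>I. if R dvd n i then of_int R else 0)"
    using assms by (simp only: sum_cis_residues)
  also have "\<dots> = (if \<forall>i\<in>I. R dvd n i then of_nat (card (residue_box I R)) else 0)"
    using assms by (auto simp: residue_box_def card_PiE)
  finally show ?thesis .
qed

text \<open>With denominators \<open>R\<close>, the multiples of \<open>R\<close> removed by the
  reduction contribute integers to the exponent.\<close>

lemma phase_box_mod:
  assumes "R > 0"
  shows "phase I (\<lambda>i. of_int (\<theta> i) / of_int R) (box_mod I R n) =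
    phase I (\<lambda>i. of_int (\<theta> i) / of_int R) n"
proof -
  have "phase I (\<lambda>i. of_int (\<theta> i) / of_int R) n =
      phase I (\<lambda>i. of_int (\<theta> i) / of_int R) (\<lambda>i. n i mod R + R * (n i div R))"
    by simp
  also have "\<dots> = phase I (\<lambda>i. of_int (\<theta> i) / of_int R) (\<lambda>i. n i mod R) *
      phase I (\<lambda>i. of_int (\<theta> i) / of_int R) (\<lambda>i. R * (n i div R))"
    by (rule phase_add)
  also have "phase I (\<lambda>i. of_int (\<theta> i) / of_int R) (\<lambda>i. R * (n i div R)) = 1"
    using assms by (simp add: phase_def cis_2pi_eq_1_iff del: of_int_div) (auto intro!: Ints_sum Ints_mult)
  also have "phase I (\<lambda>i. of_int (\<theta> i) / of_int R) (\<lambda>i. n i mod R) =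
      phase I (\<lambda>i. of_int (\<theta> i) / of_int R) (box_mod I R n)"
    by (simp add: phase_def box_mod_def cong: sum.cong)
  finally show ?thesis by simp
qed

section \<open>Moments of Fourier coefficients, large coefficients and translations\<close>

definition fourier :: "'i set \<Rightarrow> int \<Rightarrow> ('i \<Rightarrow> int) set \<Rightarrow> ('i \<Rightarrow> int) \<Rightarrow> complex"
  where "fourier I R A \<theta> = (\<Sum>n\<in>A. phase I (\<lambda>i. of_int (\<theta> i) / of_int R) n)"

text \<open>Parseval: after expanding the square, orthogonality leaves only the diagonal
  terms.\<close>

lemma sum_norm_fourier_square:
  assumes "finite I" "R > 0" "A \<subseteq> residue_box I R"
  shows "(\<Sum>\<theta>\<in>residue_box I R. (norm (fourier I R A \<theta>))\<^sup>2) = real (card (residue_box I R)) * real (card A)"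
proof -
  let ?p = "\<lambda>\<theta>. phase I (\<lambda>i. of_int (\<theta> i) / of_int R)"
  have finA: "finite A" using assms finite_subset finite_residue_box by blast
  have "of_real (\<Sum>\<theta>\<in>residue_box I R. (norm (fourier I R A \<theta>))\<^sup>2) =
      (\<Sum>\<theta>\<in>residue_box I R. fourier I R A \<theta> * cnj (fourier I R A \<theta>))"
    by (simp only: of_real_sum complex_norm_square)
  also have "\<dots> = (\<Sum>\<theta>\<in>residue_box I R. \<Sum>n\<in>A. \<Sum>m\<in>A. ?p \<theta> (\<lambda>i. n i - m i))"
    by (simp add: fourier_def sum_product phase_diff)
  also have "\<dots> = (\<Sum>n\<in>A. \<Sum>m\<in>A. \<Sum>\<theta>\<in>residue_box I R. ?p \<theta> (\<lambda>i. n i - m i))"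
    by (subst sum.swap, rule sum.cong[OF refl], rule sum.swap)
  also have "\<dots> = (\<Sum>n\<in>A. \<Sum>m\<in>A. if m = n then of_nat (card (residue_box I R)) else 0)"
  proof (intro sum.cong refl)
    fix n m assume nm: "n \<in> A" "m \<in> A"
    have "(\<forall>i\<in>I. R dvd n i - m i) \<longleftrightarrow> m = n"
      using box_cong_imp_eq[of n I R m] assms(3) nm by auto
    then show "(\<Sum>\<theta>\<in>residue_box I R. ?p \<theta> (\<lambda>i. n i - m i)) = (if m = n then of_nat (card (residue_box I R)) else 0)"
      using assms by (simp only: sum_phase_residue_box)
  qed
  also have "\<dots> = of_real (real (card (residue_box I R)) * real (card A))"
    using finA by simp
  finally show ?thesis by (simp only: of_real_eq_iff)
qed

text \<open>By orthogonality the sum is the size of the box times the number of representations of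
  \<open>x\<close> as \<open>u - v + w - z\<close> modulo \<open>R\<close> with entries from
  \<open>A\<close>, and \<open>none\<close> excludes these.\<close>

lemma sum_norm_fourier_fourth:
  assumes "finite I" "R > 0" "A \<subseteq> residue_box I R"
    and none: "\<And>u v w z. \<lbrakk>u \<in> A; v \<in> A; w \<in> A; z \<in> A\<rbrakk> \<Longrightarrow>
      \<exists>i\<in>I. \<not> R dvd u i - v i + w i - z i - x i"
  shows "(\<Sum>\<theta>\<in>residue_box I R. of_real ((norm (fourier I R A \<theta>))^4) *
    cnj (phase I (\<lambda>i. of_int (\<theta> i) / of_int R) x)) = 0"
proof -
  let ?p = "\<lambda>\<theta>. phase I (\<lambda>i. of_int (\<theta> i) / of_int R)"
  have "(\<Sum>\<theta>\<in>residue_box I R. of_real ((norm (fourier I R A \<theta>))^4) * cnj (?p \<theta> x)) =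
     (\<Sum>\<theta>\<in>residue_box I R. \<Sum>(u, v, w, z)\<in>A \<times> A \<times> A \<times> A. ?p \<theta> (\<lambda>i. u i - v i + w i - z i - x i))"
  proof (rule sum.cong[OF refl])
    fix \<theta>
    have "of_real ((norm (fourier I R A \<theta>))^4) =
        (fourier I R A \<theta> * cnj (fourier I R A \<theta>)) * (fourier I R A \<theta> * cnj (fourier I R A \<theta>))"
      by (simp add: complex_norm_square[symmetric] power4_eq_xxxx power2_eq_square)
    also have "\<dots> = (\<Sum>u\<in>A. \<Sum>v\<in>A. \<Sum>w\<in>A. \<Sum>z\<in>A.
        ?p \<theta> u * cnj (?p \<theta> v) * (?p \<theta> w * cnj (?p \<theta> z)))"
      by (simp add: fourier_def mult.assoc flip: sum_distrib_left sum_distrib_right)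
    finally show "of_real ((norm (fourier I R A \<theta>))^4) * cnj (?p \<theta> x) =
        (\<Sum>(u, v, w, z)\<in>A \<times> A \<times> A \<times> A. ?p \<theta> (\<lambda>i. u i - v i + w i - z i - x i))"
      by (simp add: sum.cartesian_product' phase_diff phase_add sum_distrib_right mult.assoc)
  qed
  also have "\<dots> = (\<Sum>(u, v, w, z)\<in>A \<times> A \<times> A \<times> A.
      \<Sum>\<theta>\<in>residue_box I R. ?p \<theta> (\<lambda>i. u i - v i + w i - z i - x i))"
    by (subst sum.swap) (simp add: case_prod_unfold)
  also have "\<dots> = 0"
  proof (rule sum.neutral, clarify)
    fix u v w z assume "u \<in> A" "v \<in> A" "w \<in> A" "z \<in> A"
    then have "\<not> (\<forall>i\<in>I. R dvd u i - v i + w i - z i - x i)" using none by blast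
    then show "(\<Sum>\<theta>\<in>residue_box I R. ?p \<theta> (\<lambda>i. u i - v i + w i - z i - x i)) = 0"
      using assms(1,2) by (simp only: sum_phase_residue_box if_False)
  qed
  finally show ?thesis .
qed

text \<open>Bogolyubov's argument. If the characters at all large coefficients were close to 1 at
  \<open>x\<close>, the weighted fourth moment in \<open>sum_norm_fourier_fourth\<close> could not
  vanish: large coefficients contribute positively, and by Parseval the small ones are too weak to
  cancel the term of the zero frequency.\<close>

lemma fourier_large_off_fourfold_differences:
  assumes I: "finite I" "R > 0" "A \<subseteq> residue_box I R" and k: "k \<ge> 1"
    and dense: "card (residue_box I R) \<le> k * card A"
    and none: "\<And>u v w z. \<lbrakk>u \<in> A; v \<in> A; w \<in> A; z \<in> A\<rbrakk> \<Longrightarrow>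
      \<exists>i\<in>I. \<not> R dvd u i - v i + w i - z i - x i"
  shows "\<exists>\<theta>\<in>residue_box I R. real (card (residue_box I R)) \<le> 4 * (real k)\<^sup>2 * norm (fourier I R A \<theta>) \<and>
    1 / 2 \<le> norm (1 - phase I (\<lambda>i. of_int (\<theta> i) / of_int R) x)"
proof (rule ccontr)
  assume neg: "\<not> ?thesis"
  define q where "q = real (card (residue_box I R))"
  define \<alpha> where "\<alpha> = real (card A)"
  define s where "s \<theta> = norm (fourier I R A \<theta>)" for \<theta>
  define c where "c \<theta> = phase I (\<lambda>i. of_int (\<theta> i) / of_int R) x" for \<theta>
  \<comment> \<open>With this threshold the fourth moment is at most
    \<open>4 * \<tau>\<^sup>2 * (q * \<alpha>)\<close>. By \<open>q \<le> k * \<alpha>\<close> this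
    is at most \<open>\<alpha> ^ 4 / (4 * k)\<close>, less than the term \<open>\<alpha> ^ 4\<close>
    of the zero frequency alone.\<close>
  define \<tau> where "\<tau> = q / (4 * (real k)\<^sup>2)"
  have fin: "finite (residue_box I R)" using I by simp
  have zero: "(\<lambda>i\<in>I. 0) \<in> residue_box I R" using I by (auto simp: residue_box_def)
  have q: "q > 0" using fin zero by (auto simp: q_def card_gt_0_iff)
  have \<alpha>: "q \<le> k * \<alpha>" using dense unfolding q_def \<alpha>_def by (metis of_nat_le_iff of_nat_mult)
  then have \<alpha>0: "\<alpha> > 0" using q by (metis \<alpha>_def le_less_trans linorder_not_le mult_eq_0_iff of_nat_0_le_iff order_less_le)
  have "(\<Sum>\<theta>\<in>residue_box I R. of_real (s \<theta> ^ 4) * cnj (c \<theta>)) = 0"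
    unfolding s_def c_def using none by (rule sum_norm_fourier_fourth[OF I])
  then have "Re (\<Sum>\<theta>\<in>residue_box I R. of_real (s \<theta> ^ 4) * cnj (c \<theta>)) = 0"
    by (simp only: zero_complex.simps)
  then have "(\<Sum>\<theta>\<in>residue_box I R. s \<theta> ^ 4 * Re (c \<theta>)) = 0" by simp
  \<comment> \<open>Subtracting the vanishing sum gives a small weight to the frequencies with
    \<open>c \<theta>\<close> near 1.\<close>
  then have "(\<Sum>\<theta>\<in>residue_box I R. s \<theta> ^ 4) = (\<Sum>\<theta>\<in>residue_box I R. s \<theta> ^ 4 * (1 - Re (c \<theta>)))"
    by (simp add: right_diff_distrib sum_subtractf)
  also have "\<dots> \<le> (\<Sum>\<theta>\<in>residue_box I R. s \<theta> ^ 4 / 2 + 2 * \<tau>\<^sup>2 * (s \<theta>)\<^sup>2)"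
  proof (rule sum_mono)
    fix \<theta> assume \<theta>: "\<theta> \<in> residue_box I R"
    have s0: "s \<theta> \<ge> 0" by (simp add: s_def)
    have Re1: "1 - Re (c \<theta>) \<le> norm (1 - c \<theta>)"
      using complex_Re_le_cmod[of "1 - c \<theta>"] by simp
    have Re2: "1 - Re (c \<theta>) \<le> 2"
      using abs_Re_le_cmod[of "c \<theta>"] by (simp add: c_def)
    \<comment> \<open>For \<open>c \<theta>\<close> near 1 the term is at most half of
      \<open>s \<theta> ^ 4\<close>, which is later absorbed on the left. Otherwise
      \<open>s \<theta> \<le> \<tau>\<close> trades two powers of \<open>s \<theta>\<close> for
      \<open>\<tau>\<^sup>2\<close>, so that Parseval applies.\<close>
    from neg \<theta> consider "norm (1 - c \<theta>) < 1 / 2" | "4 * (real k)\<^sup>2 * s \<theta> < q"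
      unfolding s_def c_def q_def by force
    then show "s \<theta> ^ 4 * (1 - Re (c \<theta>)) \<le> s \<theta> ^ 4 / 2 + 2 * \<tau>\<^sup>2 * (s \<theta>)\<^sup>2"
    proof cases
      case 1
      then have "s \<theta> ^ 4 * (1 - Re (c \<theta>)) \<le> s \<theta> ^ 4 * (1 / 2)"
        using Re1 by (intro mult_left_mono) auto
      then show ?thesis by (simp add: add_increasing2)
    next
      case 2
      then have "s \<theta> \<le> \<tau>" using k by (simp add: \<tau>_def field_simps)
      then have "(s \<theta>)\<^sup>2 \<le> \<tau>\<^sup>2" using s0 by (rule power_mono)
      then have "s \<theta> ^ 4 \<le> \<tau>\<^sup>2 * (s \<theta>)\<^sup>2"
        using mult_right_mono[of "(s \<theta>)\<^sup>2" "\<tau>\<^sup>2" "(s \<theta>)\<^sup>2"]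
        by (simp add: power4_eq_xxxx power2_eq_square mult.assoc)
      moreover have "s \<theta> ^ 4 * (1 - Re (c \<theta>)) \<le> s \<theta> ^ 4 * 2"
        using Re2 by (intro mult_left_mono) auto
      moreover have "0 \<le> s \<theta> ^ 4" by simp
      ultimately show ?thesis by linarith
    qed
  qed
  also have "\<dots> = (\<Sum>\<theta>\<in>residue_box I R. s \<theta> ^ 4) / 2 + 2 * \<tau>\<^sup>2 * (q * \<alpha>)"
    using sum_norm_fourier_square[OF I]
    by (simp add: sum.distrib sum_divide_distrib sum_distrib_left[symmetric] s_def q_def \<alpha>_def)
  finally have "(\<Sum>\<theta>\<in>residue_box I R. s \<theta> ^ 4) \<le> 4 * \<tau>\<^sup>2 * (q * \<alpha>)" by simp
  moreover have "\<alpha> ^ 4 \<le> (\<Sum>\<theta>\<in>residue_box I R. s \<theta> ^ 4)"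
  proof -
    have "s (\<lambda>i\<in>I. 0) = \<alpha>"
      by (simp add: s_def fourier_def phase_def \<alpha>_def cong: sum.cong)
    then show ?thesis
      using member_le_sum[OF zero, of "\<lambda>\<theta>. s \<theta> ^ 4"] fin by simp
  qed
  ultimately have "\<alpha> ^ 4 \<le> 4 * \<tau>\<^sup>2 * (q * \<alpha>)" by linarith
  then have "\<alpha> ^ 3 \<le> 4 * \<tau>\<^sup>2 * q"
    using \<alpha>0 by (simp add: power4_eq_xxxx power3_eq_cube mult.assoc)
  also have "\<dots> = q ^ 3 / (4 * real k ^ 4)"
    by (simp add: \<tau>_def power3_eq_cube power2_eq_square power4_eq_xxxx)
  also have "\<dots> \<le> (k * \<alpha>) ^ 3 / (4 * real k ^ 4)"
    using \<alpha> q by (intro divide_right_mono power_mono) auto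
  also have "\<dots> = \<alpha> ^ 3 / (4 * real k)"
    using k by (simp add: power_mult_distrib power3_eq_cube power4_eq_xxxx)
  finally have "\<alpha> ^ 3 * (4 * real k) \<le> \<alpha> ^ 3 * 1" using k by (simp add: field_simps)
  then have "4 * real k \<le> 1" using \<alpha>0 by (simp only: mult_le_cancel_left_pos zero_less_power)
  then show False using k by simp
qed

text \<open>Translating \<open>A\<close> by \<open>b\<close> multiplies the coefficient by the phase
  of \<open>b\<close>. Both \<open>A\<close> and its translate lie in \<open>C\<close> and have
  equal size, so each of the two sums differs from the sum over \<open>C\<close> by at most
  \<open>card C - card A\<close>.\<close>

lemma norm_fourier_shift_le:
  assumes I: "finite I" "R > 0" and A: "A \<subseteq> C" "C \<subseteq> residue_box I R"
    and shift: "\<And>n. n \<in> A \<Longrightarrow> box_mod I R (\<lambda>i. n i + b i) \<in> C"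
  shows "norm (fourier I R A \<theta>) * norm (1 - phase I (\<lambda>i. of_int (\<theta> i) / of_int R) b)
    \<le> 2 * (real (card C) - real (card A))"
proof -
  let ?p = "phase I (\<lambda>i. of_int (\<theta> i) / of_int R)"
  define A' where "A' = (\<lambda>n. box_mod I R (\<lambda>i. n i + b i)) ` A"
  have inj: "inj_on (\<lambda>n. box_mod I R (\<lambda>i. n i + b i)) A"
    using A by (intro inj_on_subset[OF inj_on_box_mod_add]) auto
  have A': "A' \<subseteq> C" "card A' = card A"
    using shift inj by (auto simp: A'_def card_image)
  have finC: "finite C" using A I finite_subset finite_residue_box by metis
  have diff: "norm ((\<Sum>n\<in>C. ?p n) - (\<Sum>n\<in>S. ?p n)) \<le> real (card C) - real (card S)"
    if "S \<subseteq> C" for S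
  proof -
    have "norm (\<Sum>n\<in>C - S. ?p n) \<le> (\<Sum>n\<in>C - S. 1)"
      by (rule order_trans[OF norm_sum]) simp
    also have "\<dots> = real (card C) - real (card S)"
      using that finC by (simp add: card_Diff_subset finite_subset card_mono of_nat_diff)
    finally show ?thesis using that finC by (simp add: sum_diff)
  qed
  have "fourier I R A \<theta> * ?p b = (\<Sum>n\<in>A. ?p (box_mod I R (\<lambda>i. n i + b i)))"
    using I by (simp add: fourier_def sum_distrib_right phase_box_mod phase_add)
  also have "\<dots> = (\<Sum>n\<in>A'. ?p n)"
    unfolding A'_def by (simp add: sum.reindex[OF inj])
  finally have "fourier I R A \<theta> * (1 - ?p b) =
      ((\<Sum>n\<in>C. ?p n) - (\<Sum>n\<in>A'. ?p n)) - ((\<Sum>n\<in>C. ?p n) - (\<Sum>n\<in>A. ?p n))"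
    by (simp add: right_diff_distrib fourier_def)
  then have "norm (fourier I R A \<theta> * (1 - ?p b)) \<le>
      (real (card C) - real (card A')) + (real (card C) - real (card A))"
    using norm_triangle_ineq4 diff[OF A'(1)] diff[OF A(1)] by (smt (verit))
  then show ?thesis using A' by (simp add: norm_mult)
qed

section \<open>Approximate characters of precompact groups\<close>

definition zmul :: "int \<Rightarrow> 'a::ab_group_add \<Rightarrow> 'a"
  where "zmul k x = (if 0 \<le> k then sum_list (replicate (nat k) x)
    else sum_list (replicate (nat (- k)) (- x)))"

lemma zmul_0 [simp]: "zmul 0 x = 0" and zmul_1 [simp]: "zmul 1 x = x"
  by (simp_all add: zmul_def)

lemma zmul_neg_int: "zmul (- int n) x = sum_list (replicate n (- x))"
  by (cases "n = 0") (simp_all add: zmul_def)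

lemma zmul_plus1: "zmul (k + 1) x = zmul k x + x"
proof (cases "0 \<le> k")
  case True
  then show ?thesis by (simp add: zmul_def nat_add_distrib)
next
  case False
  then obtain n where n: "k = - int (Suc n)" using negD by fastforce
  then have "k + 1 = - int n" by simp
  then have "zmul (k + 1) x = sum_list (replicate n (- x))" by (simp only: zmul_neg_int)
  moreover have "zmul k x = sum_list (replicate (Suc n) (- x))" unfolding n by (rule zmul_neg_int)
  ultimately show ?thesis by simp
qed

lemma zmul_add: "zmul (j + k) x = zmul j x + zmul k x"
proof (induction k rule: int_induct[where k = 0])
  case (step1 i)
  then show ?case using zmul_plus1[of "j + i" x] zmul_plus1[of i x] by (simp add: add.assoc)
next
  case (step2 i)
  then show ?case using zmul_plus1[of "j + (i - 1)" x] zmul_plus1[of "i - 1" x]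
    by (simp add: algebra_simps)
qed simp

lemma zmul_minus: "zmul (- k) x = - zmul k x"
  using zmul_add[of k "- k" x] by (simp add: eq_neg_iff_add_eq_0 add.commute)

lemma zmul_diff: "zmul (j - k) x = zmul j x - zmul k x"
  using zmul_add[of j "- k" x] by (simp add: zmul_minus)

lemma zmul_mult: "zmul (j * k) x = zmul j (zmul k x)"
proof (induction j rule: int_induct[where k = 0])
  case (step1 i)
  then show ?case by (simp add: ring_distribs zmul_add)
next
  case (step2 i)
  then show ?case by (simp add: ring_distribs zmul_diff)
qed simp

text \<open>Allowing at most \<open>n\<close> terms, rather than exactly \<open>n\<close>, makes
  these sets increase with \<open>n\<close> even when \<open>V\<close> does not contain 0.\<close>

definition nsums :: "'a::comm_monoid_add set \<Rightarrow> nat \<Rightarrow> 'a set"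
  where "nsums V n = {sum_list xs | xs. set xs \<subseteq> V \<and> length xs \<le> n}"

lemma zero_in_nsums: "0 \<in> nsums V n"
  by (auto simp: nsums_def intro!: exI[of _ "[]"])

lemma in_nsums_1: "x \<in> V \<Longrightarrow> x \<in> nsums V 1"
  by (auto simp: nsums_def intro!: exI[of _ "[x]"])

lemma nsums_mono: "V \<subseteq> W \<Longrightarrow> m \<le> n \<Longrightarrow> nsums V m \<subseteq> nsums W n"
  by (fastforce simp: nsums_def)

lemma nsums_add: "x \<in> nsums V m \<Longrightarrow> y \<in> nsums V n \<Longrightarrow> x + y \<in> nsums V (m + n)"
  unfolding nsums_def
proof clarify
  fix xs ys assume "set xs \<subseteq> V" "length xs \<le> m" "set ys \<subseteq> V" "length ys \<le> n"
  then show "\<exists>zs. sum_list xs + sum_list ys = sum_list zs \<and> set zs \<subseteq> V \<and> length zs \<le> m + n"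
    by (intro exI[of _ "xs @ ys"]) auto
qed

lemma nsums_uminus:
  fixes V :: "'a::ab_group_add set"
  assumes "\<And>v. v \<in> V \<Longrightarrow> - v \<in> V" "x \<in> nsums V n"
  shows "- x \<in> nsums V n"
proof -
  obtain xs where xs: "x = sum_list xs" "set xs \<subseteq> V" "length xs \<le> n"
    using assms(2) by (auto simp: nsums_def)
  have "- x = sum_list (map uminus xs)" unfolding xs(1) by (induction xs) simp_all
  then show ?thesis using xs assms(1) unfolding nsums_def
    by (intro CollectI exI[of _ "map uminus xs"]) auto
qed

lemma nsums_diff:
  fixes V :: "'a::ab_group_add set"
  assumes "\<And>v. v \<in> V \<Longrightarrow> - v \<in> V" "x \<in> nsums V m" "y \<in> nsums V n"
  shows "x - y \<in> nsums V (m + n)"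
  using nsums_add[OF assms(2) nsums_uminus[OF assms(1,3)]] by simp

lemma nsums_sum:
  assumes "finite E" "\<And>e. e \<in> E \<Longrightarrow> f e \<in> nsums V n"
  shows "sum f E \<in> nsums V (card E * n)"
  using assms
proof (induction E rule: finite_induct)
  case (insert e E)
  then have "f e + sum f E \<in> nsums V (n + card E * n)" by (intro nsums_add) auto
  then show ?case using insert by simp
qed (simp add: zero_in_nsums)

lemma zmul_in_nsums:
  assumes "\<And>v. v \<in> V \<Longrightarrow> - v \<in> V" "x \<in> V" "\<bar>k\<bar> \<le> int n"
  shows "zmul k x \<in> nsums V n"
proof (cases "0 \<le> k")
  case True
  then show ?thesis using assms unfolding zmul_def nsums_def
    by (simp) (rule exI[of _ "replicate (nat k) x"], auto)
next
  case False
  then show ?thesis using assms unfolding zmul_def nsums_def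
    by (simp) (rule exI[of _ "replicate (nat (- k)) (- x)"], auto)
qed

text \<open>Induction on \<open>n\<close>: continuity of addition at the origin makes room for one
  more summand, and intersecting with a reflected neighbourhood restores symmetry.\<close>

lemma symmetric_nhd_nsums_subset:
  fixes U :: "'a::topological_ab_group_add set"
  assumes "open U" "0 \<in> U"
  shows "\<exists>V. open V \<and> 0 \<in> V \<and> (\<forall>v\<in>V. - v \<in> V) \<and> nsums V n \<subseteq> U"
  using assms
proof (induction n arbitrary: U)
  case 0
  have "nsums UNIV 0 \<subseteq> {0 :: 'a}" by (auto simp: nsums_def)
  then show ?case using 0 by (intro exI[of _ UNIV]) auto
next
  case (Suc n)
  have "((\<lambda>p. fst p + snd p) \<longlongrightarrow> 0 + 0) (nhds (0::'a) \<times>\<^sub>F nhds 0)"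
    by (rule tendsto_add_Pair)
  then have "eventually (\<lambda>p. fst p + snd p \<in> U) (nhds (0::'a) \<times>\<^sub>F nhds 0)"
    using Suc.prems by (auto dest: topological_tendstoD)
  then obtain P Q where PQ: "eventually P (nhds (0::'a))" "eventually Q (nhds (0::'a))"
    "\<And>x y. P x \<Longrightarrow> Q y \<Longrightarrow> x + y \<in> U"
    by (auto simp: eventually_prod_filter)
  obtain S where S: "open S" "0 \<in> S" "\<And>x. x \<in> S \<Longrightarrow> P x"
    using PQ(1) by (auto simp: eventually_nhds)
  obtain T where T: "open T" "0 \<in> T" "\<And>x. x \<in> T \<Longrightarrow> Q x"
    using PQ(2) by (auto simp: eventually_nhds)
  obtain V where V: "open V" "0 \<in> V" "\<forall>v\<in>V. - v \<in> V" "nsums V n \<subseteq> T"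
    using Suc.IH[OF T(1,2)] by blast
  define W where "W = V \<inter> S \<inter> uminus -` S"
  have "open (uminus -` S)"
    using S by (intro open_vimage continuous_intros)
  then have "open W" "0 \<in> W" "\<forall>v\<in>W. - v \<in> W"
    using S V by (auto simp: W_def)
  moreover have "nsums W (Suc n) \<subseteq> U"
  proof
    fix x assume "x \<in> nsums W (Suc n)"
    then obtain xs where xs: "x = sum_list xs" "set xs \<subseteq> W" "length xs \<le> Suc n"
      by (auto simp: nsums_def)
    show "x \<in> U"
    proof (cases xs)
      case Nil
      then show ?thesis using xs Suc.prems by simp
    next
      case (Cons y ys)
      then have "sum_list ys \<in> nsums V n" using xs by (auto simp: nsums_def W_def)
      then have "Q (sum_list ys)" using V T by blast
      moreover have "P y" using xs Cons S by (auto simp: W_def)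
      ultimately show ?thesis using PQ(3) xs Cons by simp
    qed
  qed
  ultimately show ?case by blast
qed

text \<open>Dirichlet's pigeonhole: record for each \<open>j\<close> which of the finitely many
  translates of \<open>V\<close> contain the multiples \<open>j e\<close>. Two indices with the same
  record differ by a suitable \<open>R\<close>. This \<open>R\<close> becomes the modulus of the
  finite model.\<close>

lemma precompact_simultaneous_return:
  fixes W :: "'a::topological_ab_group_add set"
  assumes pc: "precompact_group TYPE('a)" and W: "open W" "0 \<in> W" and E: "finite E"
  shows "\<exists>R>0. \<forall>e\<in>E. zmul R e \<in> W"
proof -
  obtain V where V: "open V" "0 \<in> V" "\<forall>v\<in>V. - v \<in> V" "nsums V 2 \<subseteq> W"
    using symmetric_nhd_nsums_subset[OF W] by blast
  then obtain F where F: "finite F" "F + V = UNIV"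
    using pc unfolding precompact_group_def by blast
  have "\<exists>f\<in>F. x - f \<in> V" for x
  proof -
    have "x \<in> F + V" using F by simp
    then obtain f v where "f \<in> F" "v \<in> V" "x = f + v" by (rule set_plus_elim)
    then show ?thesis by (intro bexI[of _ f]) auto
  qed
  then obtain c where c: "\<And>x. c x \<in> F" "\<And>x. x - c x \<in> V" by metis
  define g where "g j = (\<lambda>e\<in>E. c (zmul (int j) e))" for j :: nat
  have "g ` UNIV \<subseteq> PiE E (\<lambda>_. F)" using c by (auto simp: g_def)
  then have "finite (range g)" using E F by (metis finite_PiE finite_subset)
  then have "\<not> inj g" using finite_imageD infinite_UNIV_nat by blast
  then obtain i j where ij: "g i = g j" "i < j"
    unfolding inj_def by (metis linorder_neqE_nat)
  have "zmul (int j - int i) e \<in> W" if "e \<in> E" for e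
  proof -
    have "c (zmul (int i) e) = c (zmul (int j) e)"
      using fun_cong[OF ij(1), of e] that by (simp add: g_def)
    then have "zmul (int j - int i) e =
        (zmul (int j) e - c (zmul (int j) e)) - (zmul (int i) e - c (zmul (int i) e))"
      by (simp add: zmul_diff)
    also have "\<dots> \<in> nsums V (1 + 1)"
      using V c by (intro nsums_diff in_nsums_1) auto
    finally show ?thesis using V(4) by (auto simp: numeral_2_eq_2)
  qed
  then show ?thesis using ij(2) by (intro exI[of _ "int j - int i"]) auto
qed

section \<open>Integer combinations of a finite set and their finite model\<close>

definition comb :: "'a::ab_group_add set \<Rightarrow> ('a \<Rightarrow> int) \<Rightarrow> 'a"
  where "comb E n = (\<Sum>e\<in>E. zmul (n e) e)"

lemma comb_add: "comb E (\<lambda>e. m e + n e) = comb E m + comb E n"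
  by (simp add: comb_def zmul_add sum.distrib)

lemma comb_diff: "comb E (\<lambda>e. m e - n e) = comb E m - comb E n"
  by (simp add: comb_def zmul_diff sum_subtractf)

lemma comb_box_mod: "comb E (box_mod E R n) = comb E n - comb E (\<lambda>e. R * (n e div R))"
  unfolding comb_diff[symmetric]
  by (simp add: comb_def box_mod_def minus_mult_div_eq_mod cong: sum.cong)

lemma comb_single:
  assumes "finite E" "x \<in> E"
  shows "comb E (\<lambda>e. if e = x then k else 0) = zmul k x"
proof -
  have "comb E (\<lambda>e. if e = x then k else 0) = (\<Sum>e\<in>E. if e = x then zmul k x else 0)"
    unfolding comb_def by (intro sum.cong) auto
  then show ?thesis using assms by simp
qed

lemma phase_single:
  assumes "finite E" "x \<in> E"
  shows "phase E t (\<lambda>e. if e = x then k else 0) = cis (2 * pi * (t x * of_int k))"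
proof -
  have "(\<Sum>e\<in>E. t e * of_int (if e = x then k else 0)) = (\<Sum>e\<in>E. if e = x then t x * of_int k else 0)"
    by (intro sum.cong) auto
  then show ?thesis using assms by (simp add: phase_def)
qed

lemma div_bounds:
  fixes a R :: int
  assumes "R > 0" "c * R \<le> a" "a < d * R"
  shows "c \<le> a div R" "a div R < d"
proof -
  show "c \<le> a div R" using zdiv_mono1[OF assms(2,1)] assms(1) by simp
  have "(a div R) * R \<le> a" using assms(1) by (simp flip: minus_mod_eq_div_mult)
  then have "(a div R) * R < d * R" using assms(3) by linarith
  then show "a div R < d" using assms(1) by simp
qed

text \<open>
  The group \<open>(\<int>/R)\<^sup>E\<close> serves as a finite model of the subgroup generated by \<open>E\<close>: by the hypothesis
  \<open>wrap\<close>, reduction modulo \<open>R\<close> changes a combination only by an element of \<open>B\<close>. The large Fourier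
  coefficient is that of a level set \<open>U - U + (2s+1)B\<close>, where \<open>s\<close> is chosen by pigeonhole so that
  a translation by \<open>B\<close> changes the set little.
\<close>

lemma approximate_character:
  fixes U B :: "'a::ab_group_add set"
  assumes U: "\<And>u. u \<in> U \<Longrightarrow> - u \<in> U" and B: "\<And>b. b \<in> B \<Longrightarrow> - b \<in> B"
    and F: "finite F" "\<And>x. \<exists>f\<in>F. x - f \<in> U"
    and BU: "nsums B (16 * (card F)\<^sup>2 + 1) \<subseteq> U"
    and x: "x \<notin> nsums U 13" "x \<in> E" and E: "finite E" and R: "R > 0" and M: "M \<ge> 0"
    and wrap: "\<And>w. (\<And>e. e \<in> E \<Longrightarrow> \<bar>w e\<bar> \<le> M + 4) \<Longrightarrow> comb E (\<lambda>e. R * w e) \<in> B"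
  shows "\<exists>t. (\<forall>e. t e \<in> {0..1}) \<and> 1 / 2 \<le> norm (1 - cis (2 * pi * t x)) \<and>
    (\<forall>n. (\<forall>e\<in>E. \<bar>n e\<bar> \<le> M) \<and> comb E n \<in> B \<longrightarrow> norm (1 - phase E t n) \<le> 1)"
proof -
  define k where "k = card F"
  \<comment> \<open>The number of levels: some increment is at most \<open>card Q / m\<close>, and
    \<open>2 * card Q / m\<close> equals the lower bound \<open>card Q / (4 * k\<^sup>2)\<close> for
    the large coefficient. The constant in \<open>BU\<close> covers all levels below
    \<open>m\<close>.\<close>
  define m where "m = 8 * k\<^sup>2"
  define Q where "Q = residue_box E R"
  \<comment> \<open>The first summand from \<open>B\<close> pays for the wrap-around in
    \<open>cell\<close>. Each further level adds two: one for a translation and one for its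
    wrap-around.\<close>
  define lev where "lev s = {u + b | u b. u \<in> nsums U 2 \<and> b \<in> nsums B (2 * s + 1)}" for s
  define A where "A s = {n \<in> Q. comb E n \<in> lev s}" for s
  have k: "k \<ge> 1" using F by (auto simp: k_def Suc_le_eq card_gt_0_iff)
  then have m: "m > 0" by (simp add: m_def)
  have finQ: "finite Q" using E by (simp add: Q_def)
  have AQ: "A s \<subseteq> Q" for s by (auto simp: A_def)
  have Q: "0 \<le> n e" "n e < R" if "n \<in> Q" "e \<in> E" for n e
    using that by (auto simp: Q_def residue_box_def dest: PiE_mem)
  have lev_mono: "lev s \<subseteq> lev s'" if "s \<le> s'" for s s'
    using nsums_mono[of B B "2 * s + 1" "2 * s' + 1"] that by (fastforce simp: lev_def)
  have A_mono: "A s \<subseteq> A s'" if "s \<le> s'" for s s'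
    using lev_mono[OF that] by (auto simp: A_def)
  have cardA_mono: "card (A s) \<le> card (A s')" if "s \<le> s'" for s s'
    using A_mono[OF that] AQ finQ by (meson card_mono finite_subset)
  \<comment> \<open>Subtracting a fixed member \<open>n0\<close> maps the cell injectively into
    \<open>A 0\<close>, because differences within a cell give elements of \<open>U - U\<close> up
    to wrap-around.\<close>
  have cell: "card {n \<in> Q. comb E n - f \<in> U} \<le> card (A 0)" for f
  proof (cases "{n \<in> Q. comb E n - f \<in> U} = {}")
    case True
    then show ?thesis by (simp only: card.empty)
  next
    case False
    then obtain n0 where n0: "n0 \<in> Q" "comb E n0 - f \<in> U" by blast
    define r where "r n = box_mod E R (\<lambda>e. n e + - n0 e)" for n
    have "inj_on r {n \<in> Q. comb E n - f \<in> U}"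
      unfolding r_def by (rule inj_on_subset[OF inj_on_box_mod_add]) (auto simp: Q_def)
    moreover have "r n \<in> A 0" if n: "n \<in> Q" "comb E n - f \<in> U" for n
    proof -
      have "comb E (\<lambda>e. R * ((n e - n0 e) div R)) \<in> B"
      proof (rule wrap)
        fix e assume e: "e \<in> E"
        show "\<bar>(n e - n0 e) div R\<bar> \<le> M + 4"
          using div_bounds[of R "-1" "n e - n0 e" 1] Q[OF n(1) e] Q[OF n0(1) e] R M by linarith
      qed
      then have "- comb E (\<lambda>e. R * ((n e - n0 e) div R)) \<in> nsums B (2 * 0 + 1)"
        using B in_nsums_1 by fastforce
      moreover have "(comb E n - f) - (comb E n0 - f) \<in> nsums U (1 + 1)"
        using U n n0 by (intro nsums_diff in_nsums_1) auto
      moreover have "comb E (r n) =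
          ((comb E n - f) - (comb E n0 - f)) + - comb E (\<lambda>e. R * ((n e - n0 e) div R))"
        by (simp add: r_def comb_box_mod comb_diff)
      ultimately have "comb E (r n) \<in> lev 0"
        unfolding lev_def one_add_one by blast
      then show ?thesis using R by (simp add: A_def r_def Q_def box_mod_in_residue_box)
    qed
    ultimately show ?thesis
      using AQ[of 0] finQ by (intro card_inj_on_le[of r]) (auto intro: finite_subset)
  qed
  have dense: "card Q \<le> k * card (A s)" for s
  proof -
    have "Q = (\<Union>f\<in>F. {n \<in> Q. comb E n - f \<in> U})" using F(2) by blast
    then have "card Q \<le> (\<Sum>f\<in>F. card {n \<in> Q. comb E n - f \<in> U})"
      using card_UN_le[OF F(1), of "\<lambda>f. {n \<in> Q. comb E n - f \<in> U}"] by simp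
    also have "\<dots> \<le> (\<Sum>f\<in>F. card (A 0))" by (intro sum_mono cell)
    also have "\<dots> \<le> k * card (A s)" using cardA_mono[of 0 s] by (simp add: k_def)
    finally show ?thesis .
  qed
  \<comment> \<open>The increments telescope to at most \<open>card Q\<close>, so one of the
    \<open>m\<close> increments is at most \<open>card Q / m\<close>.\<close>
  have "\<exists>s<m. (real (card (A (Suc s))) - real (card (A s))) * m \<le> card Q"
  proof (rule ccontr)
    assume neg: "\<not> ?thesis"
    have "real (card Q) < (real (card (A (Suc s))) - real (card (A s))) * m" if "s < m" for s
      using neg that by (meson not_le_imp_less)
    then have "(\<Sum>s<m. real (card Q)) < (\<Sum>s<m. (real (card (A (Suc s))) - real (card (A s))) * m)"
      using m by (intro sum_strict_mono) auto
    also have "\<dots> = (real (card (A m)) - real (card (A 0))) * m"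
      using sum_lessThan_telescope[of "\<lambda>s. real (card (A s))" m]
      by (simp flip: sum_distrib_right)
    also have "\<dots> \<le> card Q * real m"
      using card_mono[OF finQ AQ[of m]] by (intro mult_right_mono) auto
    finally show False by simp
  qed
  then obtain s where s: "s < m" "(real (card (A (Suc s))) - real (card (A s))) * m \<le> card Q"
    by blast
  \<comment> \<open>Below level \<open>m\<close> the whole part from \<open>B\<close> fits into a
    single copy of \<open>U\<close>.\<close>
  have in3: "comb E n \<in> nsums U (2 + 1)" if n: "n \<in> A s" for n
  proof -
    have "nsums B (2 * s + 1) \<subseteq> U"
      using nsums_mono[of B B "2 * s + 1" "16 * (card F)\<^sup>2 + 1"] BU s(1)
      by (auto simp: m_def k_def)
    moreover obtain u b where "comb E n = u + b" "u \<in> nsums U 2" "b \<in> nsums B (2 * s + 1)"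
      using n by (auto simp: A_def lev_def)
    ultimately show ?thesis
      using nsums_add[of u U 2 b 1] in_nsums_1[of b U] by auto
  qed
  let ?\<delta> = "\<lambda>e. if e = x then 1 else 0"
  \<comment> \<open>Otherwise \<open>x\<close> would be a signed combination of four elements of
    \<open>nsums U 3\<close> and one wrap-around term in \<open>U\<close>: this is where the 13
    comes from.\<close>
  have none: "\<exists>e\<in>E. \<not> R dvd n1 e - n2 e + n3 e - n4 e - ?\<delta> e"
    if n: "n1 \<in> A s" "n2 \<in> A s" "n3 \<in> A s" "n4 \<in> A s" for n1 n2 n3 n4
  proof (rule ccontr)
    assume "\<not> ?thesis"
    then have dvd: "R dvd n1 e - n2 e + n3 e - n4 e - ?\<delta> e" if "e \<in> E" for e
      using that by blast
    define w where "w e = (n1 e - n2 e + n3 e - n4 e - ?\<delta> e) div R" for e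
    have w: "R * w e = n1 e - n2 e + n3 e - n4 e - ?\<delta> e" if "e \<in> E" for e
      using dvd[OF that] by (simp add: w_def)
    have "comb E (\<lambda>e. R * w e) \<in> B"
    proof (rule wrap)
      fix e assume e: "e \<in> E"
      have "n \<in> Q" if "n \<in> A s" for n using that AQ by blast
      note b = Q[OF this[OF n(1)] e] Q[OF this[OF n(2)] e] Q[OF this[OF n(3)] e] Q[OF this[OF n(4)] e]
      obtain d :: int where d: "d = ?\<delta> e" "0 \<le> d" "d \<le> 1" by simp
      \<comment> \<open>Four residues and one entry of the unit vector keep the quotient between -3
        and 2, within the bound \<open>M + 4\<close>.\<close>
      have "- 3 * R \<le> n1 e - n2 e + n3 e - n4 e - d" "n1 e - n2 e + n3 e - n4 e - d < 3 * R"
        using b R d(2,3) by linarith+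
      note div_bounds[OF R this]
      then show "\<bar>w e\<bar> \<le> M + 4"
        unfolding w_def d(1)[symmetric] using M by linarith
    qed
    moreover have "nsums B 1 \<subseteq> U"
      using nsums_mono[of B B 1 "16 * (card F)\<^sup>2 + 1"] BU by simp
    ultimately have w1: "comb E (\<lambda>e. R * w e) \<in> nsums U 1"
      by (meson in_nsums_1 subsetD)
    have "comb E (\<lambda>e. R * w e) = comb E (\<lambda>e. n1 e - n2 e + n3 e - n4 e - ?\<delta> e)"
      unfolding comb_def using w by (intro sum.cong) auto
    then have "x = comb E n1 - comb E n2 + comb E n3 - comb E n4 - comb E (\<lambda>e. R * w e)" (is "x = ?y")
      using comb_single[OF E x(2), of 1] by (simp add: comb_diff comb_add)
    moreover have "?y \<in> nsums U ((2 + 1) + (2 + 1) + (2 + 1) + (2 + 1) + 1)"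
      by (intro nsums_diff nsums_add in3 n U w1)
    ultimately show False using x(1) by simp
  qed
  obtain \<theta> where \<theta>: "\<theta> \<in> Q" "real (card Q) \<le> 4 * (real k)\<^sup>2 * norm (fourier E R (A s) \<theta>)"
    "1 / 2 \<le> norm (1 - phase E (\<lambda>e. of_int (\<theta> e) / of_int R) ?\<delta>)"
    using fourier_large_off_fourfold_differences[OF E R AQ[of s, unfolded Q_def] k
        dense[of s, unfolded Q_def] none] unfolding Q_def by blast
  have q: "card Q > 0" using \<theta> finQ by (auto simp: card_gt_0_iff)
  \<comment> \<open>The frequencies vanish off \<open>E\<close>, which puts \<open>t\<close> into
    the unit cube over the whole group.\<close>
  define t where "t e = (if e \<in> E then of_int (\<theta> e) / of_int R else 0 :: real)" for e
  have pt: "phase E t n = phase E (\<lambda>e. of_int (\<theta> e) / of_int R) n" for n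
    by (simp add: phase_def t_def cong: sum.cong)
  have "t e \<in> {0..1}" for e
    using Q[OF \<theta>(1), of e] R by (auto simp: t_def)
  moreover have "1 / 2 \<le> norm (1 - cis (2 * pi * t x))"
    using \<theta>(3) phase_single[OF E x(2), of t 1] by (simp add: pt)
  moreover have "norm (1 - phase E t n) \<le> 1" if n: "\<And>e. e \<in> E \<Longrightarrow> \<bar>n e\<bar> \<le> M" "comb E n \<in> B" for n
  proof -
    \<comment> \<open>Translation by \<open>n\<close> moves level \<open>s\<close> into level
      \<open>Suc s\<close>, which is only slightly larger by the choice of \<open>s\<close>.\<close>
    have "norm (fourier E R (A s) \<theta>) * norm (1 - phase E t n) \<le>
        2 * (real (card (A (Suc s))) - real (card (A s)))"
      unfolding pt
    proof (rule norm_fourier_shift_le[OF E R])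
      show "A s \<subseteq> A (Suc s)" "A (Suc s) \<subseteq> residue_box E R"
        using A_mono AQ by (auto simp: Q_def)
      fix n' assume n': "n' \<in> A s"
      have "comb E (\<lambda>e. R * ((n' e + n e) div R)) \<in> B"
      proof (rule wrap)
        fix e assume e: "e \<in> E"
        \<comment> \<open>As \<open>R\<close> is at least 1, the bound \<open>M\<close> on
          \<open>n\<close> confines the quotient to the range from \<open>-M\<close> to
          \<open>M\<close>.\<close>
        have "M \<le> M * R" using M R by (simp add: mult_le_cancel_left1)
        moreover have "n' \<in> Q" using AQ n' by blast
        ultimately have "- M * R \<le> n' e + n e" "n' e + n e < (M + 1) * R"
          using Q[of n' e] n(1)[OF e] e by (simp_all add: distrib_right)
        note div_bounds[OF R this]
        then show "\<bar>(n' e + n e) div R\<bar> \<le> M + 4" using M by linarith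
      qed
      then have "comb E n + - comb E (\<lambda>e. R * ((n' e + n e) div R)) \<in> nsums B (1 + 1)"
        using B n by (intro nsums_add in_nsums_1) auto
      moreover obtain u b where ub: "comb E n' = u + b" "u \<in> nsums U 2" "b \<in> nsums B (2 * s + 1)"
        using n' by (auto simp: A_def lev_def)
      ultimately have "b + (comb E n + - comb E (\<lambda>e. R * ((n' e + n e) div R)))
          \<in> nsums B ((2 * s + 1) + (1 + 1))"
        by (intro nsums_add[of b])
      moreover have "comb E (box_mod E R (\<lambda>e. n' e + n e)) =
          u + (b + (comb E n + - comb E (\<lambda>e. R * ((n' e + n e) div R))))"
        by (simp add: comb_box_mod comb_add ub)
      ultimately have "comb E (box_mod E R (\<lambda>e. n' e + n e)) \<in> lev (Suc s)"
        using ub(2) by (auto simp: lev_def add.commute)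
      then show "box_mod E R (\<lambda>e. n' e + n e) \<in> A (Suc s)"
        using R by (simp add: A_def Q_def box_mod_in_residue_box)
    qed
    then have "norm (fourier E R (A s) \<theta>) * norm (1 - phase E t n) * m \<le>
        2 * (real (card (A (Suc s))) - real (card (A s))) * m"
      by (rule mult_right_mono) simp
    also have "\<dots> \<le> 2 * real (card Q)" using s(2) by (simp only: mult.assoc mult_le_cancel_left_pos zero_less_numeral)
    also have "\<dots> \<le> 2 * (4 * (real k)\<^sup>2 * norm (fourier E R (A s) \<theta>))"
      using \<theta>(2) by simp
    also have "\<dots> = norm (fourier E R (A s) \<theta>) * 1 * m"
      by (simp add: m_def)
    finally have "norm (fourier E R (A s) \<theta>) * norm (1 - phase E t n) * m \<le>
        norm (fourier E R (A s) \<theta>) * 1 * m" .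
    moreover have "norm (fourier E R (A s) \<theta>) > 0" using \<theta>(2) q by auto
    ultimately show ?thesis using m by (simp del: mult_1_right)
  qed
  ultimately show ?thesis by blast
qed

section \<open>The characters of a totally bounded group separate points\<close>

lemma zmul_distrib: "zmul k (x + y) = zmul k x + zmul k y"
proof (induction k rule: int_induct[where k = 0])
  case (step1 i)
  then show ?case by (simp add: zmul_add algebra_simps)
next
  case (step2 i)
  then show ?case by (simp add: zmul_diff algebra_simps)
qed simp

text \<open>Brings relations with different finite supports to one common finite set, where a single
  approximate character treats them all.\<close>

lemma comb_zero_extend:
  assumes "finite E'" "E \<subseteq> E'"
  shows "comb E' (\<lambda>e. if e \<in> E then n e else 0) = comb E n"
    and "phase E' t (\<lambda>e. if e \<in> E then n e else 0) = phase E t n"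
proof -
  show "comb E' (\<lambda>e. if e \<in> E then n e else 0) = comb E n"
    unfolding comb_def using assms by (intro sum.mono_neutral_cong_right) auto
  have "(\<Sum>e\<in>E'. t e * of_int (if e \<in> E then n e else 0)) = (\<Sum>e\<in>E. t e * of_int (n e))"
    using assms by (intro sum.mono_neutral_cong_right) auto
  then show "phase E' t (\<lambda>e. if e \<in> E then n e else 0) = phase E t n"
    by (simp add: phase_def)
qed

section \<open>The complex exponential and the chord norm on the circle\<close>

lift_definition circle_exp :: "circle \<Rightarrow> complex" is "\<lambda>x. cis (2 * pi * x)"
proof -
  fix x y :: real
  assume "x - y \<in> \<int>"
  then have "cis (2 * pi * (x - y)) = 1" by (simp add: cis_2pi_eq_1_iff)
  moreover have "cis (2 * pi * x) = cis (2 * pi * (x - y)) * cis (2 * pi * y)"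
    by (simp add: cis_mult algebra_simps)
  ultimately show "cis (2 * pi * x) = cis (2 * pi * y)" by simp
qed

lemma norm_circle_exp [simp]: "norm (circle_exp c) = 1"
  by transfer simp

lemma circle_exp_add: "circle_exp (c + d) = circle_exp c * circle_exp d"
  by transfer (simp add: cis_mult distrib_left)

lemma circle_exp_uminus: "circle_exp (- c) = cnj (circle_exp c)"
  by transfer (simp add: cis_cnj)

lemma circle_exp_eq_1_iff: "circle_exp c = 1 \<longleftrightarrow> c = 0"
  by transfer (simp add: cis_2pi_eq_1_iff)

lemma circle_exp_inject: "circle_exp c = circle_exp d \<longleftrightarrow> c = d"
proof
  assume "circle_exp c = circle_exp d"
  moreover have "circle_exp c = circle_exp (c - d) * circle_exp d"
    by (simp flip: circle_exp_add)
  ultimately have "circle_exp (c - d) = 1"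
    by (metis mult_cancel_right1 norm_circle_exp norm_zero zero_neq_one)
  then show "c = d" by (simp add: circle_exp_eq_1_iff)
qed simp

lemma continuous_circle_exp: "continuous_on UNIV circle_exp"
  unfolding continuous_on_open_vimage[OF open_UNIV]
proof (intro allI impI)
  fix S :: "complex set"
  assume "open S"
  then have "open ((\<lambda>x. cis (2 * pi * x)) -` S)"
    by (intro open_vimage continuous_intros)
  moreover have "to_circle -` (circle_exp -` S) = (\<lambda>x. cis (2 * pi * x)) -` S"
    by (auto simp: circle_exp.abs_eq)
  ultimately show "open (circle_exp -` S \<inter> UNIV)" by (simp add: open_circle_def)
qed

lemma compact_UNIV_circle: "compact (UNIV :: circle set)"
proof -
  have "c \<in> to_circle ` {0..1}" for c
  proof -
    obtain x where "c = to_circle x" by (metis Quotient3_abs_rep Quotient3_circle)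
    then have "c = to_circle (frac x)" by (simp add: to_circle_eq_iff frac_def)
    then show ?thesis using frac_ge_0[of x] frac_lt_1[of x] by (auto intro!: imageI)
  qed
  then have "UNIV = to_circle ` {0..1}" by blast
  moreover have "compact (to_circle ` {0..1})"
    by (intro compact_continuous_image continuous_at_imp_continuous_on ballI isCont_to_circle) simp
  ultimately show ?thesis by simp
qed

text \<open>A continuous injection of the compact circle into a Hausdorff space is a homeomorphism
  onto its image, so continuity can be tested in the complex plane.\<close>

lemma continuous_on_circle_iff:
  "continuous_on S f \<longleftrightarrow> continuous_on S (\<lambda>x. circle_exp (f x))"
proof
  assume f: "continuous_on S (\<lambda>x. circle_exp (f x))"
  have inv: "inv circle_exp (circle_exp c) = c" for c
    by (rule inv_f_f) (simp add: inj_def circle_exp_inject)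
  then have "continuous_on (range circle_exp) (inv circle_exp)"
    by (intro continuous_on_inv continuous_circle_exp compact_UNIV_circle) simp
  from continuous_on_compose2[OF this f]
  have "continuous_on S (\<lambda>x. inv circle_exp (circle_exp (f x)))" by blast
  then show "continuous_on S f" by (simp add: inv)
next
  assume "continuous_on S f"
  then show "continuous_on S (\<lambda>x. circle_exp (f x))"
    by (rule continuous_on_compose2[OF continuous_circle_exp]) simp
qed

text \<open>The length of the chord from 1 yields an invariant metric without a choice of
  representatives modulo the integers.\<close>

definition circle_norm :: "circle \<Rightarrow> real"
  where "circle_norm c = norm (1 - circle_exp c)"

lemma circle_norm_0 [simp]: "circle_norm 0 = 0"
  using circle_exp_eq_1_iff[of 0] by (simp add: circle_norm_def)

lemma circle_norm_eq_0_iff: "circle_norm c = 0 \<longleftrightarrow> c = 0"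
  using circle_exp_eq_1_iff[of c] by (auto simp: circle_norm_def)

lemma circle_norm_uminus: "circle_norm (- c) = circle_norm c"
  using complex_mod_cnj[of "1 - circle_exp c"] by (simp add: circle_norm_def circle_exp_uminus)

lemma norm_circle_exp_diff: "norm (circle_exp c - circle_exp d) = circle_norm (c - d)"
proof -
  have "circle_exp d - circle_exp c = circle_exp d * (1 - circle_exp (c - d))"
    by (simp add: right_diff_distrib flip: circle_exp_add)
  then have "norm (circle_exp d - circle_exp c) = circle_norm (c - d)"
    by (simp add: norm_mult circle_norm_def)
  then show ?thesis by (simp add: norm_minus_commute)
qed

lemma circle_norm_add_le: "circle_norm (c + d) \<le> circle_norm c + circle_norm d"
proof -
  have "circle_norm (c + d) = norm (circle_exp c - circle_exp (- d))"
    by (simp add: norm_circle_exp_diff)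
  also have "\<dots> \<le> norm (circle_exp c - circle_exp 0) + norm (circle_exp 0 - circle_exp (- d))"
    using norm_triangle_ineq[of "circle_exp c - circle_exp 0" "circle_exp 0 - circle_exp (- d)"]
    by simp
  finally show ?thesis by (simp only: norm_circle_exp_diff) simp
qed

lemma circle_norm_diff_le: "circle_norm (c - d) \<le> circle_norm c + circle_norm d"
  using circle_norm_add_le[of c "- d"] by (simp add: circle_norm_uminus)

lemma continuous_on_circle_norm:
  "continuous_on S f \<Longrightarrow> continuous_on S (\<lambda>x. circle_norm (f x))"
  unfolding circle_norm_def continuous_on_circle_iff by (intro continuous_intros)

text \<open>Write \<open>1 - z\<^sup>2\<close> as \<open>(1 - z) * (1 + z)\<close>. A chord of
  length at most 1 forces \<open>Re z \<ge> 1 / 2\<close>, hence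
  \<open>norm (1 + z) \<ge> 3 / 2\<close>.\<close>

lemma circle_norm_double:
  assumes "circle_norm c \<le> 1"
  shows "circle_norm c \<le> 2 / 3 * circle_norm (c + c)"
proof -
  define z where "z = circle_exp c"
  have z: "(Re z)\<^sup>2 + (Im z)\<^sup>2 = 1"
    using norm_circle_exp[of c] by (simp add: z_def cmod_def)
  have "(norm (1 - z))\<^sup>2 \<le> 1"
    using assms by (simp add: circle_norm_def z_def abs_square_le_1)
  then have "Re z \<ge> 1 / 2"
    using z unfolding cmod_power2 by (simp add: power2_eq_square algebra_simps)
  then have "(3 / 2)\<^sup>2 \<le> (norm (1 + z))\<^sup>2"
    using z unfolding cmod_power2 by (simp add: power2_eq_square algebra_simps)
  then have "3 / 2 \<le> norm (1 + z)" by (rule power2_le_imp_le) simp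
  then have "circle_norm c * (3 / 2) \<le> norm (1 - z) * norm (1 + z)"
    unfolding circle_norm_def z_def[symmetric] by (intro mult_left_mono) simp_all
  also have "\<dots> = norm ((1 - z) * (1 + z))" by (simp add: norm_mult)
  also have "(1 - z) * (1 + z) = 1 - circle_exp (c + c)"
    by (simp add: z_def circle_exp_add algebra_simps)
  finally show ?thesis by (simp add: circle_norm_def)
qed

lemma circle_norm_iterated_doubles:
  assumes "\<And>j. j \<le> r \<Longrightarrow> circle_norm (zmul (2 ^ j) c) \<le> 1"
  shows "circle_norm c \<le> (2 / 3) ^ r"
  using assms
proof (induction r arbitrary: c)
  case 0
  then show ?case using 0[of 0] by simp
next
  case (Suc r)
  have two: "zmul 2 c = c + c" using zmul_add[of 1 1 c] by simp
  have "circle_norm (c + c) \<le> (2 / 3) ^ r"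
  proof (rule Suc.IH)
    fix j assume "j \<le> r"
    then show "circle_norm (zmul (2 ^ j) (c + c)) \<le> 1"
      using Suc.prems[of "Suc j"] zmul_mult[of "2 ^ j" 2 c] by (simp add: two mult.commute)
  qed
  then show ?case using circle_norm_double[of c] Suc.prems[of 0] by simp
qed

text \<open>The circle has no small subgroups. This upgrades bounds by 1 to exact
  equalities.\<close>

lemma circle_norm_all_doubles_imp_0:
  assumes "\<And>j. circle_norm (zmul (2 ^ j) c) \<le> 1"
  shows "c = 0"
proof -
  have "circle_norm c \<le> (2 / 3) ^ r" for r
    using assms by (rule circle_norm_iterated_doubles)
  moreover have "(\<lambda>r. (2 / 3 :: real) ^ r) \<longlonglongrightarrow> 0"
    by (rule LIMSEQ_realpow_zero) auto
  ultimately have "circle_norm c \<le> 0" by (meson LIMSEQ_le_const)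
  then show ?thesis by (simp add: circle_norm_eq_0_iff[symmetric] circle_norm_def)
qed

lemma to_circle_diff: "to_circle (x - y) = to_circle x - to_circle y"
  by (simp add: minus_circle.abs_eq)

lemma circle_norm_to_circle: "circle_norm (to_circle s) = norm (1 - cis (2 * pi * s))"
  by (simp add: circle_norm_def circle_exp.abs_eq)

lemma zmul_to_circle: "zmul k (to_circle s) = to_circle (s * of_int k)"
proof (induction k rule: int_induct[where k = 0])
  case base
  then show ?case by (simp add: zero_circle.abs_eq)
next
  case (step1 i)
  then show ?case by (simp add: zmul_add distrib_left to_circle_add)
next
  case (step2 i)
  then show ?case by (simp add: zmul_diff right_diff_distrib to_circle_diff)
qed

section \<open>From approximate characters to a character by compactness\<close>

lemma compact_functions_into:
  fixes S :: "'b::topological_space set"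
  assumes "compact S"
  shows "compact {f :: 'a \<Rightarrow> 'b. \<forall>x. f x \<in> S}"
proof -
  have "compactin (product_topology (\<lambda>_::'a. euclidean) UNIV) (PiE UNIV (\<lambda>_. S))"
    using assms by (simp add: compactin_PiE)
  moreover have "PiE UNIV (\<lambda>_. S) = {f :: 'a \<Rightarrow> 'b. \<forall>x. f x \<in> S}"
    by (auto simp: PiE_def Pi_def extensional_def)
  ultimately show ?thesis by (simp add: euclidean_product_topology)
qed

text \<open>Approximate characters satisfy any finitely many of the conditions \<open>C i\<close>,
  and compactness gives one \<open>t\<close> satisfying all. Since the conditions also apply to
  dyadic multiples, their crude bound 1 improves itself to exact additivity and to
  continuity.\<close>

lemma dual_group_separates_points:
  fixes x :: "'a::topological_ab_group_add"
  assumes tb: "totally_bounded_group TYPE('a)" and x: "x \<noteq> 0"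
  shows "\<exists>\<gamma>\<in>dual_group. \<gamma> x \<noteq> 0"
proof -
  have pc: "precompact_group TYPE('a)" and haus: "Hausdorff_space (euclidean :: 'a topology)"
    using tb by (auto simp: totally_bounded_group_def)
  obtain U0 :: "'a set" where U0: "open U0" "0 \<in> U0" "x \<notin> U0"
    using haus x unfolding Hausdorff_space_def by (auto simp: disjnt_iff) metis
  obtain U where U: "open U" "0 \<in> U" "\<forall>u\<in>U. - u \<in> U" "nsums U 13 \<subseteq> U0"
    using symmetric_nhd_nsums_subset[OF U0(1,2)] by blast
  then obtain F where F: "finite F" "F + U = UNIV"
    using pc unfolding precompact_group_def by blast
  have FU: "\<exists>f\<in>F. y - f \<in> U" for y
  proof -
    have "y \<in> F + U" using F by simp
    then obtain f u where "f \<in> F" "u \<in> U" "y = f + u" by (rule set_plus_elim)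
    then show ?thesis by (intro bexI[of _ f]) auto
  qed
  obtain B where B: "open B" "0 \<in> B" "\<forall>b\<in>B. - b \<in> B" "nsums B (16 * (card F)\<^sup>2 + 1) \<subseteq> U"
    using symmetric_nhd_nsums_subset[OF U(1,2)] by blast
  \<comment> \<open>The cube is compact by Tychonoff; the second condition keeps the limit
    nontrivial at \<open>x\<close>.\<close>
  define K where "K = {t :: 'a \<Rightarrow> real. \<forall>e. t e \<in> {0..1}} \<inter> {t. 1 / 2 \<le> norm (1 - cis (2 * pi * t x))}"
  define I where "I = {(E, n :: 'a \<Rightarrow> int). finite E \<and> comb E n \<in> B}"
  define C where "C = (\<lambda>(E, n). {t :: 'a \<Rightarrow> real. norm (1 - phase E t n) \<le> 1})"
  have "K \<inter> (\<Inter>i\<in>I. C i) \<noteq> {}"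
  proof (rule compact_imp_fip_image)
    have "closed {t :: 'a \<Rightarrow> real. 1 / 2 \<le> norm (1 - cis (2 * pi * t x))}"
      by (intro closed_Collect_le continuous_intros continuous_on_product_coordinates)
    then show "compact K"
      unfolding K_def by (intro compact_Int_closed compact_functions_into) simp
  next
    fix i assume "i \<in> I"
    show "closed (C i)"
      unfolding C_def phase_def case_prod_unfold
      by (intro closed_Collect_le continuous_intros continuous_on_product_coordinates)
  next
    fix I' assume I': "finite I'" "I' \<subseteq> I"
    \<comment> \<open>\<open>E\<close> collects the supports of the finitely many relations together
      with \<open>x\<close>, and \<open>M\<close> dominates their coefficients.\<close>
    define E where "E = insert x (\<Union>(fst ` I'))"
    define M where "M = (\<Sum>(E, n)\<in>I'. \<Sum>e\<in>E. \<bar>n e\<bar>)"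
    have E: "finite E" using I' by (auto simp: E_def I_def)
    have M: "M \<ge> 0" unfolding M_def by (intro sum_nonneg) (auto intro: sum_nonneg)
    have nM: "\<bar>n e\<bar> \<le> M" if "(D, n) \<in> I'" "e \<in> D" for D n e
    proof -
      have "finite D" using that I' by (auto simp: I_def)
      then have "\<bar>n e\<bar> \<le> (\<Sum>e\<in>D. \<bar>n e\<bar>)" using that by (intro member_le_sum) auto
      also have "\<dots> \<le> M" unfolding M_def
        using member_le_sum[OF that(1), of "\<lambda>(E, n). \<Sum>e\<in>E. \<bar>n e\<bar>"] I' by (auto intro: sum_nonneg)
      finally show ?thesis .
    qed
    \<comment> \<open>For each of the \<open>card E\<close> elements, the wrap-around term is a sum
      of at most \<open>M + 4\<close> elements of the symmetric set \<open>W\<close>.\<close>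
    obtain W where W: "open W" "0 \<in> W" "\<forall>w\<in>W. - w \<in> W" "nsums W (card E * (nat M + 4)) \<subseteq> B"
      using symmetric_nhd_nsums_subset[OF B(1,2)] by blast
    obtain R where R: "R > 0" "\<forall>e\<in>E. zmul R e \<in> W"
      using precompact_simultaneous_return[OF pc W(1,2) E] by blast
    have wrap: "comb E (\<lambda>e. R * w e) \<in> B" if "\<And>e. e \<in> E \<Longrightarrow> \<bar>w e\<bar> \<le> M + 4" for w
    proof -
      have "zmul (w e) (zmul R e) \<in> nsums W (nat M + 4)" if "e \<in> E" for e
        using W(3) R(2) M that \<open>\<And>e. e \<in> E \<Longrightarrow> \<bar>w e\<bar> \<le> M + 4\<close> by (intro zmul_in_nsums) auto
      then have "(\<Sum>e\<in>E. zmul (w e) (zmul R e)) \<in> nsums W (card E * (nat M + 4))"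
        using E by (intro nsums_sum) auto
      then show ?thesis
        using W(4) by (auto simp: comb_def mult.commute[of R] zmul_mult)
    qed
    have "x \<in> E" by (simp add: E_def)
    have "x \<notin> nsums U 13" using U(4) U0(3) by blast
    obtain t where t: "\<forall>e. t e \<in> {0..1}" "1 / 2 \<le> norm (1 - cis (2 * pi * t x))"
      "\<forall>n. (\<forall>e\<in>E. \<bar>n e\<bar> \<le> M) \<and> comb E n \<in> B \<longrightarrow> norm (1 - phase E t n) \<le> 1"
      using approximate_character[OF U(3)[rule_format] B(3)[rule_format] F(1) FU B(4)
          \<open>x \<notin> nsums U 13\<close> \<open>x \<in> E\<close> E R(1) M wrap] by auto
    have "norm (1 - phase D t n) \<le> 1" if Dn: "(D, n) \<in> I'" for D n
    proof -
      let ?n = "\<lambda>e. if e \<in> D then n e else 0"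
      have "D \<subseteq> E" using Dn by (force simp: E_def)
      note ext = comb_zero_extend[OF E this, where n = n]
      have "comb E ?n \<in> B" using I' Dn by (auto simp: ext I_def)
      moreover have "\<forall>e\<in>E. \<bar>?n e\<bar> \<le> M" using nM[OF Dn] M by auto
      ultimately have "norm (1 - phase E t ?n) \<le> 1" using t(3)[rule_format, of ?n] by blast
      then show ?thesis by (simp only: ext)
    qed
    then have "t \<in> K \<inter> (\<Inter>i\<in>I'. C i)" using t by (auto simp: K_def C_def)
    then show "K \<inter> (\<Inter>i\<in>I'. C i) \<noteq> {}" by blast
  qed
  then obtain t where t: "1 / 2 \<le> norm (1 - cis (2 * pi * t x))"
    and le1: "\<And>E n. finite E \<Longrightarrow> comb E n \<in> B \<Longrightarrow> norm (1 - phase E t n) \<le> 1"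
    by (fastforce simp: K_def I_def C_def)
  define \<gamma> where "\<gamma> y = to_circle (t y)" for y
  have small: "circle_norm (zmul k (\<gamma> y)) \<le> 1" if "zmul k y \<in> B" for k y
  proof -
    have "norm (1 - phase {y} t (\<lambda>e. if e = y then k else 0)) \<le> 1"
      using that by (intro le1) (simp_all add: comb_single)
    then show ?thesis
      by (simp add: phase_single \<gamma>_def zmul_to_circle circle_norm_to_circle)
  qed
  have add: "\<gamma> (a + b) = \<gamma> a + \<gamma> b" for a b
  proof -
    \<comment> \<open>The combination \<open>2^j a + 2^j b - 2^j (a + b)\<close> is 0 and so lies in
      \<open>B\<close> for every \<open>j\<close>; hence no dyadic multiple of the additivity defect
      has norm above 1.\<close>
    have "circle_norm (zmul (2 ^ j) (\<gamma> a + \<gamma> b - \<gamma> (a + b))) \<le> 1" for j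
    proof -
      let ?k = "2 ^ j :: int"
      let ?E = "{a, b, a + b}"
      \<comment> \<open>Adding indicators takes care of coincidences among \<open>a\<close>,
        \<open>b\<close> and \<open>a + b\<close>.\<close>
      let ?n = "\<lambda>e. (if e = a then ?k else 0) + (if e = b then ?k else 0) - (if e = a + b then ?k else 0)"
      have "comb ?E ?n = zmul ?k a + zmul ?k b - zmul ?k (a + b)"
        unfolding comb_diff comb_add by (simp add: comb_single)
      then have "comb ?E ?n \<in> B" using B(2) by (simp add: zmul_distrib)
      then have "norm (1 - phase ?E t ?n) \<le> 1" by (intro le1) auto
      moreover have "phase ?E t ?n = cis (2 * pi * (t a * of_int ?k)) * cis (2 * pi * (t b * of_int ?k)) *
          cnj (cis (2 * pi * (t (a + b) * of_int ?k)))"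
        unfolding phase_diff phase_add by (simp add: phase_single)
      moreover have "\<dots> = cis (2 * pi * ((t a + t b - t (a + b)) * of_int ?k))"
        by (simp add: cis_cnj cis_mult algebra_simps)
      ultimately show ?thesis
        by (simp add: \<gamma>_def zmul_to_circle circle_norm_to_circle flip: to_circle_add to_circle_diff)
    qed
    then have "\<gamma> a + \<gamma> b - \<gamma> (a + b) = 0" by (rule circle_norm_all_doubles_imp_0)
    then show ?thesis by simp
  qed
  then have diff: "\<gamma> (a - b) = \<gamma> a - \<gamma> b" for a b
    using add[of "a - b" b] by simp
  have "continuous_on UNIV (\<lambda>y. circle_exp (\<gamma> y))"
    unfolding continuous_on_def
  proof (intro ballI tendstoI)
    fix a and \<epsilon> :: real assume "\<epsilon> > 0"
    then obtain r where r: "(2 / 3) ^ r < \<epsilon>"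
      using real_arch_pow_inv[of \<epsilon> "2 / 3"] by auto
    \<comment> \<open>For \<open>y - a\<close> in \<open>V\<close> the dyadic multiples up to
      \<open>2 ^ r\<close> stay in \<open>B\<close>, and going back through \<open>r\<close>
      doublings brings the norm below \<open>\<epsilon>\<close>.\<close>
    obtain V where V: "open V" "0 \<in> V" "\<forall>v\<in>V. - v \<in> V" "nsums V (2 ^ r) \<subseteq> B"
      using symmetric_nhd_nsums_subset[OF B(1,2)] by blast
    have near: "dist (circle_exp (\<gamma> y)) (circle_exp (\<gamma> a)) < \<epsilon>" if "y - a \<in> V" for y
    proof -
      have "circle_norm (zmul (2 ^ j) (\<gamma> (y - a))) \<le> 1" if "j \<le> r" for j
      proof (rule small)
        have "(2::int) ^ j \<le> 2 ^ r" using that by (simp add: power_increasing)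
        then have "zmul (2 ^ j) (y - a) \<in> nsums V (2 ^ r)"
          using V(3) \<open>y - a \<in> V\<close> by (intro zmul_in_nsums) auto
        then show "zmul (2 ^ j) (y - a) \<in> B" using V(4) by blast
      qed
      then have "circle_norm (\<gamma> (y - a)) \<le> (2 / 3) ^ r" by (rule circle_norm_iterated_doubles)
      then show ?thesis using r by (simp add: dist_norm norm_circle_exp_diff diff)
    qed
    have "open ((\<lambda>y. y - a) -` V)" using V(1) by (intro open_vimage continuous_intros)
    then show "\<forall>\<^sub>F y in at a. dist (circle_exp (\<gamma> y)) (circle_exp (\<gamma> a)) < \<epsilon>"
      unfolding eventually_at_topological using near V(2)
      by (intro exI[of _ "(\<lambda>y. y - a) -` V"]) auto
  qed
  then have "\<gamma> \<in> dual_group"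
    using add by (simp add: dual_group_def Modules.additive_def continuous_on_circle_iff[of UNIV \<gamma>])
  moreover have "\<gamma> x \<noteq> 0"
    using t by (auto simp: \<gamma>_def circle_norm_eq_0_iff[symmetric] circle_norm_to_circle)
  ultimately show ?thesis by blast
qed

section \<open>Compact subsets and Baire duals\<close>

lemma dual_group_zero: "(\<lambda>_. 0) \<in> dual_group"
  by (simp add: dual_group_def Modules.additive_def)

lemma dual_group_add: "\<phi> \<in> dual_group \<Longrightarrow> \<psi> \<in> dual_group \<Longrightarrow> (\<lambda>x. \<phi> x + \<psi> x) \<in> dual_group"
  by (auto simp: dual_group_def Modules.additive_def intro!: continuous_intros)

lemma dual_group_diff: "\<phi> \<in> dual_group \<Longrightarrow> \<psi> \<in> dual_group \<Longrightarrow> (\<lambda>x. \<phi> x - \<psi> x) \<in> dual_group"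
  by (auto simp: dual_group_def Modules.additive_def intro!: continuous_intros)

lemma dual_group_p_eq: "dual_group_p = top_of_set dual_group"
  by (simp add: dual_group_p_def euclidean_product_topology)

text \<open>The values of characters at \<open>v\<close> are closed under doubling, so a bound by 1
  on all of them forces them to vanish; separation of points then gives
  \<open>v = 0\<close>.\<close>

lemma dual_group_small_imp_0:
  fixes v :: "'a::topological_ab_group_add"
  assumes tb: "totally_bounded_group TYPE('a)"
    and small: "\<And>\<psi>. \<psi> \<in> dual_group \<Longrightarrow> circle_norm (\<psi> v) \<le> 1"
  shows "v = 0"
proof (rule ccontr)
  assume "v \<noteq> 0"
  then obtain \<gamma> where \<gamma>: "\<gamma> \<in> dual_group" "\<gamma> v \<noteq> 0"
    using dual_group_separates_points[OF tb] by blast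
  have "\<exists>\<psi>\<in>dual_group. \<psi> v = zmul (2 ^ j) (\<gamma> v)" for j
  proof (induction j)
    case 0
    then show ?case using \<gamma> by auto
  next
    case (Suc j)
    then obtain \<psi> where \<psi>: "\<psi> \<in> dual_group" "\<psi> v = zmul (2 ^ j) (\<gamma> v)" by blast
    then have "\<psi> v + \<psi> v = zmul (2 ^ Suc j) (\<gamma> v)" by (simp flip: zmul_add)
    then show ?case using dual_group_add[OF \<psi>(1) \<psi>(1)] by (intro bexI) auto
  qed
  then have "circle_norm (zmul (2 ^ j) (\<gamma> v)) \<le> 1" for j by (metis small)
  then have "\<gamma> v = 0" by (rule circle_norm_all_doubles_imp_0)
  then show False using \<gamma> by simp
qed

text \<open>Precompactness of the dual: its closure in the compact power of the circle is covered by
  translates of \<open>O'\<close>, and density allows all centres to be characters.\<close>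

lemma dual_group_translates_cover:
  fixes O' :: "('a::topological_ab_group_add \<Rightarrow> circle) set"
  assumes O': "open O'" and \<gamma>0: "\<gamma>0 \<in> O'"
  shows "\<exists>C. finite C \<and> C \<subseteq> dual_group \<and>
    (\<forall>\<psi>\<in>dual_group. \<exists>\<gamma>\<in>C. (\<lambda>x. \<psi> x - \<gamma> x + \<gamma>0 x) \<in> O')"
proof -
  define G where "G \<gamma> = (\<lambda>\<psi> x. \<psi> x - \<gamma> x + \<gamma>0 x) -` O'" for \<gamma> :: "'a \<Rightarrow> circle"
  have "compact {f :: 'a \<Rightarrow> circle. \<forall>x. f x \<in> UNIV}"
    by (rule compact_functions_into[OF compact_UNIV_circle])
  then have cpt: "compact (closure (dual_group :: ('a \<Rightarrow> circle) set))"
    using closed_Int_compact[OF closed_closure, of "UNIV :: ('a \<Rightarrow> circle) set"] by simp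
  have op: "open (G \<gamma>)" for \<gamma>
    unfolding G_def using O'
    by (intro open_vimage continuous_on_coordinatewise_then_product continuous_intros
        continuous_on_product_coordinates)
  have "closure dual_group \<subseteq> (\<Union>\<gamma>\<in>dual_group. G \<gamma>)"
  proof
    fix \<phi> :: "'a \<Rightarrow> circle" assume \<phi>: "\<phi> \<in> closure dual_group"
    \<comment> \<open>\<open>V\<close> is the set of centres whose translate of \<open>O'\<close>
      contains \<open>\<phi>\<close>. It is an open neighbourhood of \<open>\<phi>\<close>, so it
      contains a character.\<close>
    define V where "V = (\<lambda>\<gamma> x. \<phi> x - \<gamma> x + \<gamma>0 x) -` O'"
    have "open V"
      unfolding V_def using O'
      by (intro open_vimage continuous_on_coordinatewise_then_product continuous_intros
          continuous_on_product_coordinates)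
    moreover have "\<phi> \<in> V" using \<gamma>0 by (simp add: V_def)
    ultimately have "V \<inter> dual_group \<noteq> {}"
      using \<phi> open_Int_closure_eq_empty by blast
    then show "\<phi> \<in> (\<Union>\<gamma>\<in>dual_group. G \<gamma>)" by (auto simp: V_def G_def)
  qed
  then obtain C where C: "C \<subseteq> dual_group" "finite C" "closure dual_group \<subseteq> (\<Union>\<gamma>\<in>C. G \<gamma>)"
    using compactE_image[OF cpt, of dual_group G] op by metis
  have "dual_group \<subseteq> closure (dual_group :: ('a \<Rightarrow> circle) set)" by (rule closure_subset)
  with C(3) have "dual_group \<subseteq> (\<Union>\<gamma>\<in>C. G \<gamma>)" by blast
  then have "\<exists>\<gamma>\<in>C. (\<lambda>x. \<psi> x - \<gamma> x + \<gamma>0 x) \<in> O'" if "\<psi> \<in> dual_group" for \<psi>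
    using that by (auto simp: G_def)
  then show ?thesis using C(1,2) by blast
qed

text \<open>Pigeonhole on a grid of squares of side \<open>1 / 8\<close>: two points in the same
  square differ by at most \<open>1 / 8\<close> in each coordinate, hence by at most
  \<open>1 / 4\<close> in norm.\<close>

lemma infinite_imp_characters_close:
  assumes "finite C" and inf: "infinite E"
  shows "\<exists>x\<in>E. \<exists>y\<in>E. x \<noteq> y \<and> (\<forall>\<gamma>\<in>C. circle_norm (\<gamma> x - \<gamma> y) \<le> 1 / 4)"
proof -
  define cell where "cell z = (\<lfloor>8 * Re z\<rfloor>, \<lfloor>8 * Im z\<rfloor>)" for z
  define g where "g x = (\<lambda>\<gamma>\<in>C. cell (circle_exp (\<gamma> x)))" for x
  have "cell z \<in> {-8..8} \<times> {-8..8}" if "norm z = 1" for z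
    using abs_Re_le_cmod[of z] abs_Im_le_cmod[of z] that
    by (auto simp: cell_def le_floor_iff floor_le_iff)
  then have "g ` E \<subseteq> PiE C (\<lambda>_. {-8..8} \<times> {-8..8})" by (auto simp: g_def)
  then have "finite (g ` E)" using \<open>finite C\<close> by (rule finite_subset[OF _ finite_PiE]) auto
  then have "\<not> inj_on g E" using inf finite_imageD by blast
  then obtain x y where xy: "x \<in> E" "y \<in> E" "x \<noteq> y" "g x = g y" by (auto simp: inj_on_def)
  have fl: "\<bar>r - s\<bar> \<le> 1 / 8" if "\<lfloor>8 * r\<rfloor> = \<lfloor>8 * s\<rfloor>" for r s :: real
    using that by linarith
  have "circle_norm (\<gamma> x - \<gamma> y) \<le> 1 / 4" if "\<gamma> \<in> C" for \<gamma>
  proof -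
    define u v where "u = circle_exp (\<gamma> x)" and "v = circle_exp (\<gamma> y)"
    have "cell u = cell v" using fun_cong[OF xy(4), of \<gamma>] that by (simp add: g_def u_def v_def)
    then have "\<lfloor>8 * Re u\<rfloor> = \<lfloor>8 * Re v\<rfloor>" "\<lfloor>8 * Im u\<rfloor> = \<lfloor>8 * Im v\<rfloor>" by (auto simp: cell_def)
    then have "\<bar>Re (u - v)\<bar> \<le> 1 / 8" "\<bar>Im (u - v)\<bar> \<le> 1 / 8" by (simp_all only: minus_complex.sel fl)
    then have "norm (u - v) \<le> 1 / 4" using cmod_le[of "u - v"] by linarith
    then show ?thesis by (simp add: u_def v_def norm_circle_exp_diff)
  qed
  then show ?thesis using xy by blast
qed

text \<open>If no \<open>T k\<close> had interior, the complements would be dense open sets with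
  empty intersection.\<close>

lemma Baire_space_countable_closed_cover:
  fixes T :: "nat \<Rightarrow> 'a set"
  assumes B: "Baire_space X" and ne: "topspace X \<noteq> {}"
    and cl: "\<And>k. closedin X (T k)" and cover: "topspace X \<subseteq> (\<Union>k. T k)"
  shows "\<exists>k V. openin X V \<and> V \<noteq> {} \<and> V \<subseteq> T k"
proof (rule ccontr)
  assume neg: "\<not> ?thesis"
  define \<U> where "\<U> = range (\<lambda>k. topspace X - T k)"
  have "X closure_of (topspace X - T k) = topspace X" for k
  proof -
    have "\<not> V \<subseteq> T k" if "openin X V" "x \<in> V" for V x using neg that by blast
    moreover have "V \<subseteq> topspace X" if "openin X V" for V using that by (rule openin_subset)
    ultimately show ?thesis unfolding closure_of_def by fast
  qed
  then have "\<forall>U\<in>\<U>. openin X U \<and> X closure_of U = topspace X"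
    using cl by (simp add: \<U>_def openin_diff)
  moreover have "countable \<U>" by (simp add: \<U>_def)
  ultimately have "X closure_of (topspace X \<inter> \<Inter>\<U>) = topspace X"
    using B unfolding Baire_space_def by blast
  moreover have "topspace X \<inter> \<Inter>\<U> = {}" using cover by (auto simp: \<U>_def)
  ultimately show False using ne by simp
qed

theorem theorem2p8:
  fixes K :: "'a::topological_ab_group_add set"
  assumes "totally_bounded_group TYPE('a)"
    and "Baire_space (dual_group_p :: ('a \<Rightarrow> circle) topology)"
    and "compact K"
  shows "finite K"
proof (rule ccontr)
  assume inf: "infinite K"
  have "compact_space (top_of_set K)" using assms(3) by (simp add: compact_space_subtopology)
  moreover have "Hausdorff_space (top_of_set K)"
    using assms(1) by (simp add: totally_bounded_group_def Hausdorff_space_subtopology)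
  ultimately obtain a and E :: "nat \<Rightarrow> 'a set" where E: "\<And>k. infinite (E k)"
    "\<And>U. openin (top_of_set K) U \<Longrightarrow> a \<in> U \<Longrightarrow> \<exists>k. E k \<subseteq> U" and a: "a \<in> K"
    using infinite_compact_countable_network_at_point[of "top_of_set K"] inf
    unfolding topspace_euclidean_subtopology by metis
  \<comment> \<open>With \<open>1 / 8\<close> here and \<open>1 / 4\<close> on the finite set
    \<open>C\<close>, the final sum \<open>1 / 4 + 4 * (1 / 8)\<close> stays below the bound 1 in
    \<open>dual_group_small_imp_0\<close>.\<close>
  define T where
    "T k = {\<gamma> \<in> dual_group. \<forall>y\<in>E k. circle_norm (\<gamma> y - \<gamma> a) \<le> 1 / 8}" for k
  have "closedin (top_of_set dual_group) (T k)" for k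
  proof -
    have "closed {\<gamma> :: 'a \<Rightarrow> circle. circle_norm (\<gamma> y - \<gamma> a) \<le> 1 / 8}" for y
      by (intro closed_Collect_le continuous_intros continuous_on_circle_norm
          continuous_on_product_coordinates)
    then have "closed (\<Inter>y\<in>E k. {\<gamma> :: 'a \<Rightarrow> circle. circle_norm (\<gamma> y - \<gamma> a) \<le> 1 / 8})" by blast
    moreover have "T k = dual_group \<inter> (\<Inter>y\<in>E k. {\<gamma>. circle_norm (\<gamma> y - \<gamma> a) \<le> 1 / 8})"
      by (auto simp: T_def)
    ultimately show ?thesis by (simp only: closedin_closed_Int)
  qed
  moreover have "dual_group \<subseteq> (\<Union>k. T k)"
  proof
    fix \<gamma> :: "'a \<Rightarrow> circle" assume \<gamma>: "\<gamma> \<in> dual_group"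
    then have cont: "continuous_on UNIV (\<lambda>y. circle_norm (\<gamma> y - \<gamma> a))"
      by (intro continuous_on_circle_norm continuous_intros) (simp add: dual_group_def)
    have "open {y. circle_norm (\<gamma> y - \<gamma> a) < 1 / 8}"
      by (intro open_Collect_less cont continuous_intros)
    then have "openin (top_of_set K) (K \<inter> {y. circle_norm (\<gamma> y - \<gamma> a) < 1 / 8})"
      by (rule openin_open_Int)
    then obtain k where "E k \<subseteq> K \<inter> {y. circle_norm (\<gamma> y - \<gamma> a) < 1 / 8}"
      using E(2) a by force
    then have "\<gamma> \<in> T k" using \<gamma> by (force simp: T_def)
    then show "\<gamma> \<in> (\<Union>k. T k)" by blast
  qed
  ultimately obtain k V where V: "openin (top_of_set dual_group) V" "V \<noteq> {}" "V \<subseteq> T k"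
    using Baire_space_countable_closed_cover[OF assms(2)[unfolded dual_group_p_eq], of T]
      dual_group_zero by auto
  then obtain O' where O': "open O'" "V = dual_group \<inter> O'" by (auto simp: openin_open)
  then obtain \<gamma>0 where \<gamma>0: "\<gamma>0 \<in> dual_group" "\<gamma>0 \<in> O'" using V(2) by blast
  obtain C where C: "finite C" "C \<subseteq> dual_group"
    "\<And>\<psi>. \<psi> \<in> dual_group \<Longrightarrow> \<exists>\<gamma>\<in>C. (\<lambda>x. \<psi> x - \<gamma> x + \<gamma>0 x) \<in> O'"
    using dual_group_translates_cover[OF O'(1) \<gamma>0(2)] by blast
  obtain y z where yz: "y \<in> E k" "z \<in> E k" "y \<noteq> z"
    and close: "\<And>\<gamma>. \<gamma> \<in> C \<Longrightarrow> circle_norm (\<gamma> y - \<gamma> z) \<le> 1 / 4"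
    using infinite_imp_characters_close[OF C(1) E(1)] by metis
  have "circle_norm (\<psi> (y - z)) \<le> 1" if \<psi>: "\<psi> \<in> dual_group" for \<psi>
  proof -
    obtain \<gamma> where \<gamma>: "\<gamma> \<in> C" "(\<lambda>x. \<psi> x - \<gamma> x + \<gamma>0 x) \<in> O'" using C(3)[OF \<psi>] by blast
    \<comment> \<open>Both \<open>\<tau>\<close> and \<open>\<gamma>0\<close> lie in
      \<open>T k\<close>, so writing \<open>\<psi>\<close> as
      \<open>\<gamma> + (\<tau> - \<gamma>0)\<close> reduces it to a member of \<open>C\<close>, up
      to four deviations from values at \<open>a\<close>.\<close>
    define \<tau> where "\<tau> x = \<psi> x - \<gamma> x + \<gamma>0 x" for x
    have "\<tau> \<in> dual_group"
      unfolding \<tau>_def using \<psi> \<gamma>(1) C(2) \<gamma>0(1) by (intro dual_group_add dual_group_diff) auto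
    moreover have "\<tau> \<in> O'" unfolding \<tau>_def by (rule \<gamma>(2))
    ultimately have "\<tau> \<in> T k" "\<gamma>0 \<in> T k" using \<gamma>0 O' V(3) by auto
    then have \<delta>: "circle_norm (\<phi> x - \<phi> a) \<le> 1 / 8" if "\<phi> \<in> {\<tau>, \<gamma>0}" "x \<in> {y, z}" for \<phi> x
      using that yz by (auto simp: T_def)
    have "\<psi> (y - z) = \<psi> y - \<psi> z"
      using \<psi> by (simp add: dual_group_def additive.diff)
    also have "\<dots> = (\<gamma> y - \<gamma> z) + (((\<tau> y - \<tau> a) - (\<tau> z - \<tau> a)) - ((\<gamma>0 y - \<gamma>0 a) - (\<gamma>0 z - \<gamma>0 a)))"
      by (simp add: \<tau>_def algebra_simps)
    also have "circle_norm \<dots> \<le> 1 / 4 + ((1 / 8 + 1 / 8) + (1 / 8 + 1 / 8))"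
      by (intro order_trans[OF circle_norm_add_le] order_trans[OF circle_norm_diff_le]
          add_mono close \<gamma>(1) \<delta>) simp_all
    finally show ?thesis by simp
  qed
  then have "y - z = 0" by (rule dual_group_small_imp_0[OF assms(1)])
  then show False using yz(3) by simp
qed

end
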